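(* For $m\ge 1$ and any positive integers $l_1,\dots,l_m$, the permutation $I_{l_1}\ominus I_{l_2}\ominus\cdots\ominus I_{l_m}$ is an odd thread, and the even threads entangled with it are exactly the permutations of the form $\pi_1\ominus 1\ominus\pi_2\ominus 1\ominus\cdots\ominus 1\ominus\pi_m$, where $\pi_j$ is a $3412$-avoiding involution of length $l_j-1$ for $1\le j\le m$.
   Context: Permutations are written in one-line notation; $S_n$ is the set of permutations of $\{1,\dots,n\}$, $|\pi|$ is the length of $\pi$, and $1$ denotes the permutation of length one. For $\pi\in S_n$, $\sigma\in S_m$, $\pi\ominus\sigma\in S_{n+m}$ has $(\pi\ominus\sigma)(j)=m+\pi(j)$ for $j\le n$ and $\sigma(j-n)$ for $j>n$. $\emptyset$ is the empty permutation (length $0$), an identity for $\ominus$. $@$ is a formal symbol, the "antipermutation", regarded as the unique permutation of length $-1$. $I_n$ is the increasing permutation $12\cdots n$. An involution is a permutation equal to its inverse; a permutation avoids $3412$ (classical pattern avoidance) if it has no subsequence with the same relative order as $3412$; $\emptyset$ is a $3412$-avoiding involution. The permutation induced by $\pi$ on a set of its entries is the standardization of the corresponding subsequence. A complete Baxter permutation is a permutation $\pi$ of length $2n+1$ such that $\pi(i)$ is even iff $i$ is even, and whenever $\pi(x)=i$, $\pi(y)=i+1$ and $z$ lies strictly between $x$ and $y$, then $\pi(z)<i$ if $i$ is odd and $\pi(z)>i+1$ if $i$ is even. A permutation is alternating if it begins with an ascent and its ascents and descents alternate; it is doubly alternating if it and its inverse are alternating (permutations of length $\le 1$ are doubly alternating).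 A permutation $\sigma$ of length $n\ge 0$ is a snow leopard permutation if there is a complete Baxter permutation of length $2n+1$ whose even entries induce $\sigma$ and whose odd entries induce a doubly alternating permutation (of length $n+1$). By convention $@$ is also a snow leopard permutation; "odd length" includes length $-1$. Snow leopard permutations preserve parity ($\pi(j)$ is even iff $j$ is even). For a parity-preserving $\pi$, $\pi^e$ and $\pi^o$ are the permutations induced by $\pi$ on its even and odd entries; if $|\pi|=2n+1\ge 1$ then $|\pi^e|=n$, $|\pi^o|=n+1$. By convention $@^e=@$, $@^o=\emptyset$. An even thread (resp. odd thread) is a permutation of the form $\pi^e$ (resp. $\pi^o$) for some snow leopard permutation $\pi$ of odd length. An even thread $\alpha$ and an odd thread $\beta$ are entangled if there is a snow leopard permutation $\pi$ of odd length with $\pi^e=\alpha$ and $\pi^o=\beta$. *)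

theory Defs
  imports "HOL-Library.Sublist" "HOL-Combinatorics.Multiset_Permutations"
begin

text \<open>
  A permutation of length \<open>n\<close> is the list of its values in one-line notation; the empty list
  is the empty permutation. Positions are numbered from 1, as in \<open>ent\<close>.
\<close>

definition is_perm :: "nat list \<Rightarrow> bool" where
  "is_perm \<pi> \<longleftrightarrow> \<pi> \<in> permutations_of_set {1..length \<pi>}"

definition ent :: "nat list \<Rightarrow> nat \<Rightarrow> nat" where
  "ent \<pi> j = \<pi> ! (j - 1)"

definition perm_inverse :: "nat list \<Rightarrow> nat list" where
  "perm_inverse \<pi> =
     map (\<lambda>i. THE j. 1 \<le> j \<and> j \<le> length \<pi> \<and> ent \<pi> j = i) [1..<Suc (length \<pi>)]"

definition involution :: "nat list \<Rightarrow> bool" where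
  "involution \<pi> \<longleftrightarrow> is_perm \<pi> \<and> perm_inverse \<pi> = \<pi>"

definition same_relative_order :: "nat list \<Rightarrow> nat list \<Rightarrow> bool" where
  "same_relative_order xs ys \<longleftrightarrow> length xs = length ys \<and>
     (\<forall>i<length xs. \<forall>j<length xs. xs ! i < xs ! j \<longleftrightarrow> ys ! i < ys ! j)"

definition avoids :: "nat list \<Rightarrow> nat list \<Rightarrow> bool" where
  "avoids \<pi> \<tau> \<longleftrightarrow> \<not> (\<exists>xs. subseq xs \<pi> \<and> same_relative_order xs \<tau>)"

text \<open>For a list of distinct entries, each entry is replaced by its rank.\<close>

definition standardize :: "nat list \<Rightarrow> nat list" where
  "standardize xs = map (\<lambda>x. card {y \<in> set xs. y \<le> x}) xs"

definition induced_on :: "(nat \<Rightarrow> bool) \<Rightarrow> nat list \<Rightarrow> nat list" where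
  "induced_on P \<pi> = standardize (filter P \<pi>)"

definition skew_sum :: "nat list \<Rightarrow> nat list \<Rightarrow> nat list" (infixr "\<ominus>" 65) where
  "\<pi> \<ominus> \<sigma> = map (\<lambda>x. length \<sigma> + x) \<pi> @ \<sigma>"

definition incr_perm :: "nat \<Rightarrow> nat list" where
  "incr_perm n = [1..<Suc n]"

text \<open>\<open>skew_sums [\<pi>\<^sub>1, \<dots>, \<pi>\<^sub>m]\<close> is \<open>\<pi>\<^sub>1 \<ominus> \<dots> \<ominus> \<pi>\<^sub>m\<close>.\<close>

definition skew_sums :: "nat list list \<Rightarrow> nat list" where
  "skew_sums \<pi>s = foldr skew_sum \<pi>s []"

text \<open>\<open>skew_sums_sep1 [\<pi>\<^sub>1, \<dots>, \<pi>\<^sub>m]\<close> is \<open>\<pi>\<^sub>1 \<ominus> 1 \<ominus> \<pi>\<^sub>2 \<ominus> 1 \<ominus> \<dots> \<ominus> 1 \<ominus> \<pi>\<^sub>m\<close>, for \<open>m \<ge> 1\<close>.\<close>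

fun skew_sums_sep1 :: "nat list list \<Rightarrow> nat list" where
  "skew_sums_sep1 [] = []"
| "skew_sums_sep1 [\<pi>] = \<pi>"
| "skew_sums_sep1 (\<pi> # \<rho> # \<pi>s) = \<pi> \<ominus> [1] \<ominus> skew_sums_sep1 (\<rho> # \<pi>s)"

definition complete_baxter :: "nat list \<Rightarrow> bool" where
  "complete_baxter \<pi> \<longleftrightarrow> is_perm \<pi> \<and> odd (length \<pi>) \<and>
     (\<forall>i\<in>{1..length \<pi>}. even (ent \<pi> i) \<longleftrightarrow> even i) \<and>
     (\<forall>x\<in>{1..length \<pi>}. \<forall>y\<in>{1..length \<pi>}. \<forall>z i.
        ent \<pi> x = i \<and> ent \<pi> y = i + 1 \<and> min x y < z \<and> z < max x y \<longrightarrow>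
          (if odd i then ent \<pi> z < i else ent \<pi> z > i + 1))"

text \<open>Ascents exactly at the odd positions; vacuous for length at most 1.\<close>

definition alternating :: "nat list \<Rightarrow> bool" where
  "alternating \<pi> \<longleftrightarrow> (\<forall>i. 1 \<le> i \<and> i < length \<pi> \<longrightarrow>
     (if odd i then ent \<pi> i < ent \<pi> (i + 1) else ent \<pi> i > ent \<pi> (i + 1)))"

definition doubly_alternating :: "nat list \<Rightarrow> bool" where
  "doubly_alternating \<pi> \<longleftrightarrow> alternating \<pi> \<and> alternating (perm_inverse \<pi>)"

text \<open>Permutations together with the antipermutation, which has length \<open>-1\<close>.\<close>

datatype eperm = Antiperm | Perm "nat list"

fun elength :: "eperm \<Rightarrow> int" where
  "elength Antiperm = - 1"
| "elength (Perm \<pi>) = int (length \<pi>)"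

fun snow_leopard :: "eperm \<Rightarrow> bool" where
  "snow_leopard Antiperm \<longleftrightarrow> True"
| "snow_leopard (Perm \<sigma>) \<longleftrightarrow> is_perm \<sigma> \<and>
     (\<exists>\<pi>. complete_baxter \<pi> \<and> length \<pi> = 2 * length \<sigma> + 1 \<and>
        induced_on even \<pi> = \<sigma> \<and> doubly_alternating (induced_on odd \<pi>))"

fun even_part :: "eperm \<Rightarrow> eperm" where
  "even_part Antiperm = Antiperm"
| "even_part (Perm \<pi>) = Perm (induced_on even \<pi>)"

fun odd_part :: "eperm \<Rightarrow> eperm" where
  "odd_part Antiperm = Perm []"
| "odd_part (Perm \<pi>) = Perm (induced_on odd \<pi>)"

definition even_thread :: "eperm \<Rightarrow> bool" where
  "even_thread \<alpha> \<longleftrightarrow> (\<exists>\<pi>. snow_leopard \<pi> \<and> odd (elength \<pi>) \<and> \<alpha> = even_part \<pi>)"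

definition odd_thread :: "eperm \<Rightarrow> bool" where
  "odd_thread \<beta> \<longleftrightarrow> (\<exists>\<pi>. snow_leopard \<pi> \<and> odd (elength \<pi>) \<and> \<beta> = odd_part \<pi>)"

definition entangled :: "eperm \<Rightarrow> eperm \<Rightarrow> bool" where
  "entangled \<alpha> \<beta> \<longleftrightarrow> even_thread \<alpha> \<and> odd_thread \<beta> \<and>
     (\<exists>\<pi>. snow_leopard \<pi> \<and> odd (elength \<pi>) \<and> even_part \<pi> = \<alpha> \<and> odd_part \<pi> = \<beta>)"

end

theory Submission
  imports Defs
begin

text \<open>
  Everything rests on one recursive decomposition.  Snow leopard permutations of odd length come
  from complete Baxter permutations of length \<open>3\<close> modulo \<open>4\<close> whose odd entries are doubly
  alternating, and these are exactly the permutations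
  \<open>(12 \<oplus> \<Pi>\<^sub>1\<^sup>c \<oplus> 12) \<ominus> 1 \<ominus> \<Pi>\<^sub>2\<close>, where \<open>\<Pi>\<^sub>1\<close> and \<open>\<Pi>\<^sub>2\<close> are again of this kind or the
  antipermutation, and \<open>\<^sup>c\<close> is the complement.  As the antipermutation has length \<open>-1\<close>,
  \<open>12 \<oplus> @ \<oplus> 12\<close> is \<open>123\<close> and \<open>1 \<ominus> @\<close> is empty.  Such permutations are therefore indexed by binary
  trees (type \<open>shape\<close>), with the antipermutation at the leaves.

  The difficult direction is that every such permutation decomposes.  The Baxter condition is
  equivalent to its own inverse, so it controls neighbouring positions (\<open>baxter_inv\<close>) as well as
  neighbouring values; together with double alternation this fixes on which side of each odd entry
  the adjacent even positions and even values lie.  An odd entry whose neighbours all lie above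
  and to the right is then shown to be the lower left corner of an interval, a set of consecutive
  positions carrying consecutive values (\<open>da_baxter_block\<close>).  The interval is built from left to
  right: past the corner there follow smaller intervals anchored at their upper left corner, which
  exist by induction applied to the complement, and finally an upper right corner.  For the first
  entry of the permutation this interval is the left summand \<open>12 \<oplus> \<Pi>\<^sub>1\<^sup>c \<oplus> 12\<close>
  (\<open>da_baxter_first_block\<close>).

  Taking even entries of the decomposition, and then even and odd entries of the resulting snow
  leopard permutations, gives for a tree with subtrees \<open>a\<close> and \<open>b\<close> the odd thread
  \<open>(1 \<oplus> e(a)\<^sup>c \<oplus> 1) \<ominus> o(b)\<close> and the even thread \<open>o(a)\<^sup>c \<ominus> 1 \<ominus> e(b)\<close>, where \<open>e\<close> and \<open>o\<close> are the even
  and odd threads of the subtrees (\<open>thread_pairs\<close>).  So an odd thread is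
  \<open>I\<^bsub>l\<^sub>1\<^esub> \<ominus> \<dots> \<ominus> I\<^bsub>l\<^sub>m\<^esub>\<close> precisely when the left subtrees \<open>a\<^sub>1, \<dots>, a\<^sub>m\<close> along the right spine are
  leaves or have decreasing even threads, and the even thread is then \<open>o(a\<^sub>1)\<^sup>c \<ominus> 1 \<ominus> \<dots> \<ominus> 1 \<ominus> o(a\<^sub>m)\<^sup>c\<close>.  Unfolding
  the recursion once more, the complements \<open>o(a)\<^sup>c\<close> that occur are obtained from the empty
  permutation by the two rules \<open>\<rho> \<mapsto> 1 \<oplus> \<rho>\<close> and \<open>(\<sigma>, \<rho>) \<mapsto> (1 \<ominus> \<sigma> \<ominus> 1) \<oplus> \<rho>\<close>, and so is every
  3412-avoiding involution: split off the cycle of the first entry (\<open>inv3412_decompose\<close>).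
\<close>

section \<open>Alternating complete Baxter permutations of an integer interval\<close>

lemma residue_pred:
  fixes e \<delta> :: int
  assumes "e mod 4 = (\<delta> + 1) mod 4" "\<delta> = 1 \<or> \<delta> = 3"
  shows "even e" "(e - 1) mod 4 = \<delta>" "(e + 1) mod 4 \<noteq> \<delta>" "odd (e + 1)" "(e + 1) mod 4 = 4 - \<delta>"
proof -
  consider "\<delta> = 1" "e mod 4 = 2" | "\<delta> = 3" "e mod 4 = 0" using assms by auto
  then show "even e" "(e - 1) mod 4 = \<delta>" "(e + 1) mod 4 \<noteq> \<delta>" "odd (e + 1)" "(e + 1) mod 4 = 4 - \<delta>"
    by (cases; presburger)+
qed

lemma residue_corner:
  fixes t y d \<delta> :: int
  assumes "t mod 4 = \<delta>" "y mod 4 = \<delta>" "d mod 4 = 4 - \<delta>" "\<delta> = 1 \<or> \<delta> = 3"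
  shows "(t - (y - d)) mod 4 \<noteq> \<delta>"
  using assms(4)
proof
  assume "\<delta> = 1" then show ?thesis using assms(1-3) by presburger
next
  assume "\<delta> = 3" then show ?thesis using assms(1-3) by presburger
qed

lemma int_crossing:
  fixes a b :: int
  assumes "a \<le> b" "P a" "\<not> P b"
  shows "\<exists>i. a \<le> i \<and> i < b \<and> P i \<and> \<not> P (i + 1)"
  using assms
proof (induction b rule: int_ge_induct)
  case base then show ?case by simp
next
  case (step i)
  show ?case
  proof (cases "P i")
    case True then show ?thesis using step by auto
  next
    case False
    then show ?thesis using step by force
  qed
qed

text \<open>
  A complete Baxter permutation \<open>f\<close> of \<open>{1..N}\<close> with a condition on its odd entries:
  from one odd position to the next \<open>f\<close> rises exactly at the positions congruent to \<open>\<delta>\<close> modulo 4,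
  and likewise for the positions of successive odd values.  For \<open>\<delta> = 1\<close> this says that the odd
  entries are doubly alternating; \<open>\<delta> = 3\<close> is what complementation produces, and the induction below
  needs both.  Positions and values are integers, so that complements and shifts involve no
  truncated subtraction.
\<close>

locale da_baxter =
  fixes \<delta> N :: int and f :: "int \<Rightarrow> int"
  assumes phase: "\<delta> = 1 \<or> \<delta> = 3"
    and size: "N > 0" "N mod 4 = 3"
    and bij: "bij_betw f {1..N} {1..N}"
    and parity: "x \<in> {1..N} \<Longrightarrow> even (f x) \<longleftrightarrow> even x"
    and baxter: "\<lbrakk>x \<in> {1..N}; y \<in> {1..N}; f y = f x + 1; min x y < z; z < max x y\<rbrakk>
      \<Longrightarrow> if odd (f x) then f z < f x else f z > f y"
    and alt: "\<lbrakk>odd x; x \<ge> 1; x + 2 \<le> N\<rbrakk> \<Longrightarrow> f x < f (x + 2) \<longleftrightarrow> x mod 4 = \<delta>"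
    and alt_inv: "\<lbrakk>x \<in> {1..N}; y \<in> {1..N}; odd (f x); f y = f x + 2\<rbrakk>
      \<Longrightarrow> x < y \<longleftrightarrow> f x mod 4 = \<delta>"
begin

definition pos :: "int \<Rightarrow> int" where "pos = inv_into {1..N} f"

lemma range: "x \<in> {1..N} \<Longrightarrow> f x \<in> {1..N}"
  using bij by (auto simp: bij_betw_def)

lemma pos_range: "u \<in> {1..N} \<Longrightarrow> pos u \<in> {1..N}"
  using bij unfolding pos_def by (metis bij_betw_imp_surj_on inv_into_into)

lemma f_pos: "u \<in> {1..N} \<Longrightarrow> f (pos u) = u"
  using bij unfolding pos_def by (metis bij_betw_imp_surj_on f_inv_into_f)

lemma pos_f: "x \<in> {1..N} \<Longrightarrow> pos (f x) = x"
  using bij unfolding pos_def by (metis bij_betw_imp_inj_on inv_into_f_f)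

lemma f_eq: "x \<in> {1..N} \<Longrightarrow> y \<in> {1..N} \<Longrightarrow> f x = f y \<longleftrightarrow> x = y"
  using pos_f by metis

lemma baxter_odd: "\<lbrakk>x \<in> {1..N}; y \<in> {1..N}; f y = f x + 1; odd (f x);
    x < z \<and> z < y \<or> y < z \<and> z < x\<rbrakk> \<Longrightarrow> f z < f x"
  using baxter[of x y z] by (auto simp: min_def max_def split: if_splits)

lemma baxter_even: "\<lbrakk>x \<in> {1..N}; y \<in> {1..N}; f y = f x + 1; even (f x);
    x < z \<and> z < y \<or> y < z \<and> z < x\<rbrakk> \<Longrightarrow> f z > f y"
  using baxter[of x y z] by (auto simp: min_def max_def split: if_splits)

text \<open>
  The Baxter condition passes to the inverse permutation.  If a value between \<open>f x\<close> and \<open>f (x + 1)\<close>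
  sat on the wrong side, then walking through the values from it to the far one of the two would
  cross the gap between positions \<open>x\<close> and \<open>x + 1\<close>: there are values \<open>i\<close> and \<open>i + 1\<close> on different
  sides.  One of the entries at \<open>x\<close> and \<open>x + 1\<close> lies strictly between their positions, which
  determines the parity of \<open>i\<close>.  By parity the other one is not \<open>i\<close> or \<open>i + 1\<close> either, so it also lies
  strictly between, and it demands the opposite parity.
\<close>

lemma baxter_inv:
  assumes x: "x \<in> {1..N}" "x + 1 \<in> {1..N}" and z: "z \<in> {1..N}"
    and btw: "f x < f z \<and> f z < f (x + 1) \<or> f (x + 1) < f z \<and> f z < f x"
  shows "if odd x then z < x else z > x + 1"
proof (rule ccontr)
  assume neg: "\<not> ?thesis"
  have zne: "z \<noteq> x" "z \<noteq> x + 1" using btw by auto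
  have px: "even (f x) = even x" "even (f (x+1)) = odd x" using parity x by auto
  have rng: "f x \<in> {1..N}" "f (x+1) \<in> {1..N}" "f z \<in> {1..N}" using range x z by auto
  \<comment> \<open>Walking from \<open>u\<close> to \<open>v\<close> through all values crosses the gap somewhere.\<close>
  have cross: "\<exists>i a b. u \<le> i \<and> i < v \<and> a \<in> {1..N} \<and> b \<in> {1..N} \<and> f a = i \<and> f b = i + 1 \<and>
      (a \<le> x \<longleftrightarrow> pos u \<le> x) \<and> (b \<le> x \<longleftrightarrow> pos v \<le> x)"
    if uv: "u \<in> {1..N}" "v \<in> {1..N}" "u < v" "(pos u \<le> x) \<noteq> (pos v \<le> x)" for u v
  proof -
    obtain i where i: "u \<le> i" "i < v" "(pos i \<le> x) = (pos u \<le> x)" "(pos (i+1) \<le> x) \<noteq> (pos u \<le> x)"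
      using int_crossing[of u v "\<lambda>i. (pos i \<le> x) = (pos u \<le> x)"] uv by auto
    then have "i \<in> {1..N}" "i + 1 \<in> {1..N}" using uv by auto
    then show ?thesis using i uv(4) f_pos pos_range by metis
  qed
  have pp: "pos (f x) = x" "pos (f (x+1)) = x + 1" "pos (f z) = z" using pos_f x z by auto
  consider (1) "odd x" "f x < f (x+1)" | (2) "odd x" "f x > f (x+1)"
    | (3) "even x" "f x < f (x+1)" | (4) "even x" "f x > f (x+1)" using btw by fastforce
  then show False
  proof cases
    case 1
    then have zz: "z > x + 1" "f x < f z" "f z < f (x+1)" using neg zne btw by auto
    obtain a b where ab: "f x \<le> f a" "f a < f z" "a \<in> {1..N}" "b \<in> {1..N}" "f b = f a + 1" "a \<le> x" "x < b"
      using cross[of "f x" "f z"] rng pp zz by force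
    have "b \<noteq> x + 1" using ab zz by auto
    then have b: "b > x + 1" using ab by auto
    have "even (f a)" using baxter_odd[of a b "x+1"] ab b zz by force
    then have "a \<noteq> x" using px 1 by auto
    then have "f x > f b" using baxter_even[of a b x] ab b \<open>even (f a)\<close> by force
    then show False using ab by auto
  next
    case 2
    then have zz: "z > x + 1" "f x > f z" "f z > f (x+1)" using neg zne btw by auto
    obtain a b where ab: "f z \<le> f a" "f a < f x" "a \<in> {1..N}" "b \<in> {1..N}" "f b = f a + 1" "b \<le> x" "x < a"
      using cross[of "f z" "f x"] rng pp zz by force
    have "a \<noteq> x + 1" using ab zz by auto
    then have b: "a > x + 1" using ab by auto
    have o: "odd (f a)" using baxter_even[of a b "x+1"] ab b zz by force
    then have "b \<noteq> x" using px 2 ab by auto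
    then have "f x < f a" using baxter_odd[of a b x] ab b o by force
    then show False using ab by auto
  next
    case 3
    then have zz: "z < x" "f x < f z" "f z < f (x+1)" using neg zne btw by auto
    obtain a b where ab: "f z \<le> f a" "f a < f (x+1)" "a \<in> {1..N}" "b \<in> {1..N}" "f b = f a + 1" "a \<le> x" "x < b"
      using cross[of "f z" "f (x+1)"] rng pp zz by force
    have "a \<noteq> x" using ab zz by auto
    then have b: "a < x" using ab by auto
    have o: "odd (f a)" using baxter_even[of a b x] ab b zz by force
    then have "b \<noteq> x + 1" using px 3 ab by auto
    then have "f (x+1) < f a" using baxter_odd[of a b "x+1"] ab b o by force
    then show False using ab by auto
  next
    case 4
    then have zz: "z < x" "f x > f z" "f z > f (x+1)" using neg zne btw by auto
    obtain a b where ab: "f (x+1) \<le> f a" "f a < f z" "a \<in> {1..N}" "b \<in> {1..N}" "f b = f a + 1" "b \<le> x" "x < a"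
      using cross[of "f (x+1)" "f z"] rng pp zz by force
    have "b \<noteq> x" using ab zz by auto
    then have b: "b < x" using ab by auto
    have o: "even (f a)" using baxter_odd[of a b x] ab b zz by force
    then have "a \<noteq> x + 1" using px 4 ab by auto
    then have "f (x+1) > f b" using baxter_even[of a b "x+1"] ab b o by force
    then show False using ab by auto
  qed
qed

text \<open>
  If the even entry did not lie between the odd entries next to it, one of these would violate
  \<open>baxter_inv\<close>.
\<close>

lemma step_pos:
  assumes "odd x" "x \<ge> 1" "x + 2 \<le> N"
  shows "if x mod 4 = \<delta> then f x < f (x + 1) \<and> f (x + 1) < f (x + 2)
         else f x > f (x + 1) \<and> f (x + 1) > f (x + 2)"
proof -
  have r: "x \<in> {1..N}" "x + 1 \<in> {1..N}" "x + 2 \<in> {1..N}" using assms by auto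
  have d: "f x \<noteq> f (x+1)" "f (x+1) \<noteq> f (x+2)" "f x \<noteq> f (x+2)" using f_eq r by auto
  have a: "\<not> (f x < f (x+2) \<and> f (x+2) < f (x+1))" "\<not> (f x > f (x+2) \<and> f (x+2) > f (x+1))"
    using baxter_inv[of x "x+2"] r assms by auto
  have b: "\<not> (f (x+1) < f x \<and> f x < f (x+2))" "\<not> (f (x+2) < f x \<and> f x < f (x+1))"
    using baxter_inv[of "x+1" x] r assms by (auto simp: add.assoc)
  show ?thesis using alt[OF assms] a b d by auto
qed

text \<open>
  The same statement for the inverse, where the Baxter condition itself gives the contradiction.
\<close>

lemma step_val:
  assumes "odd u" "u \<ge> 1" "u + 2 \<le> N"
  shows "if u mod 4 = \<delta> then pos u < pos (u + 1) \<and> pos (u + 1) < pos (u + 2)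
         else pos u > pos (u + 1) \<and> pos (u + 1) > pos (u + 2)"
proof -
  define a b c where abc: "a = pos u" "b = pos (u+1)" "c = pos (u+2)"
  have r: "a \<in> {1..N}" "b \<in> {1..N}" "c \<in> {1..N}" "f a = u" "f b = u + 1" "f c = u + 2"
    using assms f_pos pos_range unfolding abc by auto
  have d: "a \<noteq> b" "b \<noteq> c" "a \<noteq> c" using r by auto
  have 1: "\<not> (a < c \<and> c < b)" "\<not> (b < c \<and> c < a)"
    using baxter_odd[of a b c] r assms by auto
  have 2: "\<not> (b < a \<and> a < c)" "\<not> (c < a \<and> a < b)"
    using baxter_even[of b c a] r assms by auto
  have "(a < c) = (u mod 4 = \<delta>)" using alt_inv[of a c] r assms by auto
  then show ?thesis using 1 2 d unfolding abc[symmetric] by auto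
qed

text \<open>
  The next four lemmas record on which side of an odd entry the adjacent even positions and even
  values lie.  Positions congruent to \<open>\<delta>\<close> are local minima among their neighbours, and values
  congruent to \<open>\<delta>\<close> are placed to the left of their neighbours.
\<close>

lemma right_up: "x \<in> {1..N} \<Longrightarrow> x mod 4 = \<delta> \<Longrightarrow> x < N \<Longrightarrow> f (x + 1) > f x \<and> f (x + 2) > f (x + 1) \<and> x + 2 \<le> N"
proof -
  assume a: "x \<in> {1..N}" "x mod 4 = \<delta>" "x < N"
  then have "odd x" using phase by presburger
  moreover have "x + 2 \<le> N" using a phase size by presburger
  ultimately show ?thesis using step_pos[of x] a by auto
qed

lemma left_up: "x \<in> {1..N} \<Longrightarrow> x mod 4 = \<delta> \<Longrightarrow> x > 1 \<Longrightarrow> f (x - 1) > f x"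
proof -
  assume a: "x \<in> {1..N}" "x mod 4 = \<delta>" "x > 1"
  then have "odd x" "(x - 2) mod 4 \<noteq> \<delta>" "odd (x - 2)" "x - 2 \<ge> 1" using phase by presburger+
  then show ?thesis using step_pos[of "x-2"] a by auto
qed

lemma val_right:
  assumes a: "x \<in> {1..N}" "f x mod 4 = \<delta>" 
  shows "f x < N \<Longrightarrow> pos (f x + 1) > x" "f x > 1 \<Longrightarrow> pos (f x - 1) > x"
proof -
  have r: "f x \<in> {1..N}" using range a by blast
  have "odd (f x)" using a(2) phase by presburger
  note r = r this
  show "pos (f x + 1) > x" if "f x < N"
  proof -
    have "f x + 2 \<le> N" using that r size by presburger
    then show ?thesis using step_val[of "f x"] a r pos_f by auto
  qed
  show "pos (f x - 1) > x" if "f x > 1"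
  proof -
    have "f x - 2 \<ge> 1" "(f x - 2) mod 4 \<noteq> \<delta>" "odd (f x - 2)" using that r a phase by presburger+
    then show ?thesis using step_val[of "f x - 2"] a r pos_f by auto
  qed
qed

lemma val_left:
  assumes a: "x \<in> {1..N}" "odd x" "f x mod 4 \<noteq> \<delta>" 
  shows "f x < N \<Longrightarrow> pos (f x + 1) < x" "f x > 1 \<Longrightarrow> pos (f x - 1) < x"
proof -
  have r: "f x \<in> {1..N}" "odd (f x)" using range a parity by auto
  show "pos (f x + 1) < x" if "f x < N"
  proof -
    have "f x + 2 \<le> N" using that r size by presburger
    then show ?thesis using step_val[of "f x"] a r pos_f by auto
  qed
  show "pos (f x - 1) < x" if "f x > 1"
  proof -
    have "f x - 2 \<ge> 1" "(f x - 2) mod 4 = \<delta>" "odd (f x - 2)" using that r a phase by presburger+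
    then show ?thesis using step_val[of "f x - 2"] a r pos_f by auto
  qed
qed

lemma complement: "da_baxter (4 - \<delta>) N (\<lambda>x. N + 1 - f x)"
proof
  show "4 - \<delta> = 1 \<or> 4 - \<delta> = 3" using phase by auto
  show "N > 0" "N mod 4 = 3" using size by auto
  have "bij_betw (\<lambda>x. N + 1 - x) {1..N} {1..N}"
    by (rule bij_betwI[of _ _ _ "\<lambda>x. N + 1 - x"]) auto
  from bij_betw_trans[OF bij this] show "bij_betw (\<lambda>x. N + 1 - f x) {1..N} {1..N}"
    by (simp add: comp_def)
  fix x assume x: "x \<in> {1..N}"
  show "even (N + 1 - f x) = even x" using parity[OF x] size by presburger
next
  fix x y z assume x: "x \<in> {1..N}" "y \<in> {1..N}" "N + 1 - f y = N + 1 - f x + 1" "min x y < z" "z < max x y"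
  have "if odd (f y) then f z < f y else f z > f x" using baxter[of y x z] x by (auto simp: min.commute max.commute)
  moreover have "odd (f y) \<longleftrightarrow> even (N + 1 - f x)" using x size by presburger
  ultimately show "if odd (N + 1 - f x) then N + 1 - f z < N + 1 - f x else N + 1 - f y < N + 1 - f z"
    using x by auto
next
  fix x assume x: "odd x" "1 \<le> x" "x + 2 \<le> N"
  have "f x \<noteq> f (x+2)" using f_eq[of x "x+2"] x by auto
  then have "(N + 1 - f x < N + 1 - f (x + 2)) = (x mod 4 \<noteq> \<delta>)" using alt[OF x] by auto
  then show "(N + 1 - f x < N + 1 - f (x + 2)) = (x mod 4 = 4 - \<delta>)" using x phase by presburger
next
  fix x y assume x: "x \<in> {1..N}" "y \<in> {1..N}" "odd (N + 1 - f x)" "N + 1 - f y = N + 1 - f x + 2"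
  have "x \<noteq> y" using x by auto
  have "f x = f y + 2" using x(4) by simp
  moreover have "odd (f y)" using x(3) calculation size(2) by presburger
  ultimately have "odd (f y)" "f x = f y + 2" by blast+
  then have "y < x \<longleftrightarrow> f y mod 4 = \<delta>" using alt_inv[of y x] x by auto
  then have "(x < y) = (f y mod 4 \<noteq> \<delta>)" using \<open>x \<noteq> y\<close> by auto
  moreover have "(f y mod 4 \<noteq> \<delta>) = ((N + 1 - (f y + 2)) mod 4 = 4 - \<delta>)"
    using \<open>odd (f y)\<close> size(2) phase by presburger
  ultimately show "(x < y) = ((N + 1 - f x) mod 4 = 4 - \<delta>)" using \<open>f x = f y + 2\<close> by simp
qed

end

section \<open>Interval blocks\<close>

text \<open>
  The block grows to the right from its lower left corner \<open>(x, f x)\<close>.  At any stage the positions from \<open>x\<close> to some even \<open>e\<close> form a block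
  whose last entry is its maximum.  The next odd entry lies above.  If its value is not congruent to
  \<open>\<delta>\<close>, then the value just below it is placed further left, which forces it to be \<open>f e + 1\<close>: it
  completes the block.  Otherwise the entry is an upper left corner, that is, a lower left corner in
  the complement, and by induction on the number of positions to the right it starts a smaller
  block.  That block begins right above \<open>f e\<close>, and it is followed by the next larger value, so the
  situation at \<open>e\<close> recurs further to the right.
\<close>

theorem da_baxter_block:
  assumes "da_baxter \<delta> N f" "x \<in> {1..N}" "x mod 4 = \<delta>" "f x mod 4 = \<delta>"
  shows "\<exists>y. x + 2 \<le> y \<and> y \<le> N \<and> y mod 4 \<noteq> \<delta> \<and> odd y \<and> f y = f x + (y - x) \<and> f (x + 1) = f x + 1 \<and>
    f (y - 1) = f y - 1 \<and> (\<forall>z\<in>{1..N}. z \<in> {x..y} \<longleftrightarrow> f z \<in> {f x..f y})"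
  using assms
proof (induction "nat (N - x)" arbitrary: \<delta> f x rule: less_induct)
  case less
  interpret da_baxter \<delta> N f by (rule less.prems)
  note x = less.prems(2-4)
  have odds: "odd x" "odd (f x)" using x phase by presburger+
  have fx: "f x \<in> {1..N}" using range x by auto
  have "x < N"
  proof (rule ccontr)
    assume "\<not> x < N"
    then have xN: "x = N" using x by auto
    have "N \<ge> 3" using size by presburger
    then have "f x < N \<or> f x > 1" using fx by auto
    then have "pos (f x + 1) > N \<and> f x < N \<or> pos (f x - 1) > N \<and> f x > 1"
      using val_right[OF x(1,3)] xN by blast
    then show False using pos_range[of "f x + 1"] pos_range[of "f x - 1"] fx by auto
  qed
  note ru = right_up[OF x(1,2) this]
  have x1: "x + 1 \<in> {1..N}" using x ru by auto
  have start: "f (x + 1) = f x + 1"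
  proof (rule ccontr)
    assume "f (x + 1) \<noteq> f x + 1"
    then have gt: "f x + 1 < f (x + 1)" using ru by auto
    then have r: "f x + 1 \<in> {1..N}" using fx range[OF x1] by auto
    then have "pos (f x + 1) > x" using val_right[of x] x by auto
    moreover have "pos (f x + 1) < x"
      using baxter_inv[OF x(1) x1 pos_range[OF r]] gt odds by (auto simp: f_pos[OF r])
    ultimately show False by simp
  qed
  \<comment> \<open>\<open>Q e\<close>: positions \<open>x..e\<close> form a block with maximum at its right end, and \<open>e\<close> is even.\<close>
  define Q where "Q = (\<lambda>e. x < e \<and> e \<le> N \<and> e mod 4 = (\<delta> + 1) mod 4 \<and> f e = f x + (e - x) \<and>
     (\<forall>z\<in>{1..N}. z \<in> {x..e} \<longleftrightarrow> f z \<in> {f x..f e}))"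
  have "\<exists>y. x + 2 \<le> y \<and> y \<le> N \<and> y mod 4 \<noteq> \<delta> \<and> odd y \<and> f y = f x + (y - x) \<and>
    f (y - 1) = f y - 1 \<and> (\<forall>z\<in>{1..N}. z \<in> {x..y} \<longleftrightarrow> f z \<in> {f x..f y})" if "Q e" for e
    using that
  proof (induction "nat (N - e)" arbitrary: e rule: less_induct)
    case inner: less
    have e: "x < e" "e \<le> N" "e mod 4 = (\<delta> + 1) mod 4" "f e = f x + (e - x)"
      "\<And>z. z \<in> {1..N} \<Longrightarrow> z \<in> {x..e} \<longleftrightarrow> f z \<in> {f x..f e}"
      using inner.prems unfolding Q_def by blast+
    have ev: "even e" "(e - 1) mod 4 = \<delta>" "(e + 1) mod 4 \<noteq> \<delta>" "odd (e + 1)"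
      "(e + 1) mod 4 = 4 - \<delta>"
      using residue_pred[OF e(3) phase] by blast+
    have "odd N" using size(2) by presburger
    then have "e \<noteq> N" using ev(1) by blast
    then have "e + 1 \<le> N" using e(2) by simp
    note ev = ev this
    have r: "e \<in> {1..N}" "e + 1 \<in> {1..N}" using e(1,2) x(1) \<open>e + 1 \<le> N\<close> by auto
    define t where "t = f (e + 1)"
    have tN: "t \<in> {1..N}" using range[OF r(2)] t_def by simp
    have "e - 1 \<in> {1..N}" using e(1,2) x by auto
    from right_up[OF this ev(2)] have te: "t > f e" using e(2) unfolding t_def by (simp add: add.commute)
    have todd: "odd t" using parity[OF r(2)] ev t_def by simp
    have btw: "pos v > e + 1" if "f e < v" "v < t" for v
    proof -
      have v: "v \<in> {1..N}" using that tN range[OF r(1)] by auto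
      show ?thesis using baxter_inv[OF r pos_range[OF v]] that ev unfolding f_pos[OF v] t_def by auto
    qed
    show ?case
    proof (cases "t mod 4 = \<delta>")
      case False
      have t1: "t > 1" using te range[OF r(1)] by auto
      have "pos (t - 1) < e + 1" using val_left[of "e + 1"] r ev False t1 unfolding t_def by auto
      then have "\<not> f e < t - 1" using btw[of "t - 1"] by auto
      then have t: "t = f e + 1" using te by auto
      have "z \<in> {x..e+1} \<longleftrightarrow> f z \<in> {f x..f (e+1)}" if z: "z \<in> {1..N}" for z
      proof -
        have "f z = f (e+1) \<longleftrightarrow> z = e + 1" using f_eq z r by auto
        then show ?thesis using e(5)[OF z] t e(1,4) unfolding t_def by auto
      qed
      then show ?thesis using t e(1,4) ev(3,4) \<open>e + 1 \<le> N\<close> unfolding t_def by (intro exI[of _ "e+1"]) auto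
    next
      case True
      have cm: "(N + 1 - t) mod 4 = 4 - \<delta>" using True phase size(2) by presburger
      have "nat (N - (e + 1)) < nat (N - x)" using e(1,2) by simp
      \<comment> \<open>The smaller block \<open>[e + 1..y] \<times> [f y..t]\<close>, read off the complement.\<close>
      from less.hyps[OF this complement r(2) ev(5) cm[unfolded t_def]]
      obtain y where y0: "e + 1 + 2 \<le> y" "y \<le> N" "y mod 4 \<noteq> 4 - \<delta>" "odd y"
        "N + 1 - f y = N + 1 - f (e + 1) + (y - (e + 1))"
        and y6: "\<forall>z\<in>{1..N}. z \<in> {e+1..y} \<longleftrightarrow> N + 1 - f z \<in> {N + 1 - f (e+1)..N + 1 - f y}"
        by blast
      then have y: "e + 3 \<le> y" "y \<le> N" "y mod 4 \<noteq> 4 - \<delta>" "odd y" by auto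
      have fy: "f y = t - (y - (e + 1))" using y0(5) t_def by auto
      have blk: "z \<in> {e+1..y} \<longleftrightarrow> f z \<in> {f y..t}" if "z \<in> {1..N}" for z
      proof -
        have "z \<in> {e+1..y} \<longleftrightarrow> N + 1 - f z \<in> {N + 1 - f (e+1)..N + 1 - f y}" using y6 that by blast
        also have "\<dots> \<longleftrightarrow> f z \<in> {f y..t}" unfolding t_def by auto
        finally show ?thesis .
      qed
      have yr: "y \<in> {1..N}" using y(1,2) e(1) x(1) by auto
      have ym: "y mod 4 = \<delta>" using y(3,4) phase by presburger
      have fym: "f y mod 4 \<noteq> \<delta>" using residue_corner[OF True ym ev(5) phase] fy by simp
      have fyN: "f y \<in> {1..N}" using range yr by auto
      have "f y > f e" using blk[OF r(1)] te by auto
      \<comment> \<open>Otherwise \<open>f y - 1\<close> would lie left of \<open>y\<close> and, being between \<open>f e\<close> and \<open>t\<close>, right of \<open>e + 1\<close>, hence in the block with minimum \<open>f y\<close>.\<close>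
      have bot: "f y = f e + 1"
      proof (rule ccontr)
        assume "f y \<noteq> f e + 1"
        then have gt: "f e < f y - 1" using \<open>f y > f e\<close> by auto
        then have pr: "f y - 1 \<in> {1..N}" using range[OF r(1)] fyN by auto
        have "pos (f y - 1) < y" using val_left[of y] yr y fym pr by auto
        moreover have "pos (f y - 1) > e + 1" using btw[of "f y - 1"] gt fy y by auto
        ultimately show False using blk[OF pos_range[OF pr]] f_pos[OF pr] by auto
      qed
      have pt: "pos (t + 1) > e + 1" if "t < N" using val_right[of "e+1"] r True that unfolding t_def by auto
      \<comment> \<open>A smaller block at the right border would also reach the value \<open>N\<close>, leaving no room for \<open>f (x - 1) > f x\<close>.\<close>
      have "y < N"
      proof (rule ccontr)
        assume "\<not> y < N"
        then have yN: "y = N" using y by auto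
        have tt: "t = N"
        proof (rule ccontr)
          assume "t \<noteq> N"
          then have tr: "t < N" "t + 1 \<in> {1..N}" using tN by auto
          show False using blk[OF pos_range[OF tr(2)]] f_pos[OF tr(2)] pt[OF tr(1)] pos_range[OF tr(2)] yN by auto
        qed
        have "\<delta> = 3" using yN ym size by auto
        then have "x > 1" using x by (cases "x = 1") auto
        then have lu: "f (x - 1) > f x" "x - 1 \<in> {1..N}" using left_up x by auto
        have "f (x - 1) \<le> t" using tt range[OF lu(2)] by auto
        then have "f (x - 1) \<in> {f x..f e} \<or> f (x - 1) \<in> {f y..t}" using lu bot by auto
        then show False using e(5)[OF lu(2)] blk[OF lu(2)] e(1) by auto
      qed
      note up = right_up[OF yr ym this]
      have y1: "y + 1 \<in> {1..N}" using up yr by auto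
      have "f (y + 1) > t" using blk[OF y1] up by auto
      have nxt: "f (y + 1) = t + 1"
      proof (rule ccontr)
        assume "f (y + 1) \<noteq> t + 1"
        then have gt: "f (y + 1) > t + 1" using \<open>f (y + 1) > t\<close> by auto
        then have tr: "t < N" "t + 1 \<in> {1..N}" using range[OF y1] tN by auto
        have "pos (t + 1) < y"
          using baxter_inv[OF yr y1 pos_range[OF tr(2)]] f_pos[OF tr(2)] gt y fy by auto
        then show False using pt[OF tr(1)] blk[OF pos_range[OF tr(2)]] f_pos[OF tr(2)] by auto
      qed
      have "z \<in> {x..y+1} \<longleftrightarrow> f z \<in> {f x..f (y+1)}" if z: "z \<in> {1..N}" for z
      proof -
        have "f z = f (y+1) \<longleftrightarrow> z = y + 1" using f_eq z y1 by auto
        moreover have "z \<in> {x..y+1} \<longleftrightarrow> z \<in> {x..e} \<or> z \<in> {e+1..y} \<or> z = y + 1"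
          using e(1) y(1) by auto
        moreover have "f z \<in> {f x..f (y+1)} \<longleftrightarrow> f z \<in> {f x..f e} \<or> f z \<in> {f y..t} \<or> f z = f (y+1)"
          using bot nxt fy e(1,4) y(1) by auto
        ultimately show ?thesis using e(5)[OF z] blk[OF z] by blast
      qed
      moreover have "(y + 1) mod 4 = (\<delta> + 1) mod 4" using ym phase by presburger
      ultimately have "Q (y + 1)" unfolding Q_def using nxt bot fy e(1,4) up y(1) by auto
      then show ?thesis using inner.hyps[of "y + 1"] y(1) \<open>y < N\<close> by auto
    qed
  qed
  moreover have "Q (x + 1)"
  proof -
    have "z \<in> {x..x+1} \<longleftrightarrow> f z \<in> {f x..f (x+1)}" if z: "z \<in> {1..N}" for z
    proof -
      have "f z = f (x+1) \<longleftrightarrow> z = x + 1" "f z = f x \<longleftrightarrow> z = x" using f_eq z x1 x by auto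
      then show ?thesis using start by auto
    qed
    moreover have "(x + 1) mod 4 = (\<delta> + 1) mod 4" using x(2) by presburger
    ultimately show ?thesis unfolding Q_def using start x1 by auto
  qed
  ultimately show ?case using start by blast
qed

text \<open>
  For the first position the block reaches up to the largest value: if the top right corner were
  smaller than \<open>N\<close>, the next value would lie to its left, hence inside the block.  What follows the
  block is the value just below it, by \<open>baxter_inv\<close> at the last position of the block.
\<close>

theorem da_baxter_first_block:
  assumes "da_baxter 1 N f"
  shows "\<exists>L. 3 \<le> L \<and> L \<le> N \<and> L mod 4 = 3 \<and> f 1 = N - L + 1 \<and> f 2 = N - L + 2 \<and> f (L - 1) = N - 1 \<and> f L = N \<and>
    (\<forall>z\<in>{1..N}. z \<le> L \<longleftrightarrow> f z > N - L) \<and> (L < N \<longrightarrow> f (L + 1) = N - L)"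
proof -
  interpret da_baxter 1 N f by (rule assms)
  have one: "1 \<in> {1..N}" using size by auto
  have f1: "f 1 \<in> {1..N}" "odd (f 1)" using range parity one by auto
  have "f 1 mod 4 = 1"
  proof (rule ccontr)
    assume n: "f 1 mod 4 \<noteq> 1"
    then have "f 1 > 1" using f1 by (cases "f 1 = 1") auto
    then have "pos (f 1 - 1) < 1" using val_left[of 1] one n by auto
    then show False using pos_range[of "f 1 - 1"] f1 \<open>f 1 > 1\<close> by auto
  qed
  then obtain y where y: "3 \<le> y" "y \<le> N" "y mod 4 \<noteq> 1" "odd y" "f y = f 1 + (y - 1)" "f 2 = f 1 + 1"
    "f (y - 1) = f y - 1" "\<And>z. z\<in>{1..N} \<Longrightarrow> z \<in> {1..y} \<longleftrightarrow> f z \<in> {f 1..f y}"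
    using da_baxter_block[OF assms one] that by fastforce
  have yr: "y \<in> {1..N}" using y by auto
  have fyr: "f y \<in> {1..N}" using range[OF yr] .
  have ym: "y mod 4 = 3" using y by presburger
  have fym: "f y mod 4 \<noteq> 1" using y(5) \<open>f 1 mod 4 = 1\<close> ym by presburger
  have top: "f y = N"
  proof (rule ccontr)
    assume "f y \<noteq> N"
    then have l: "f y < N" "f y + 1 \<in> {1..N}" using fyr by auto
    then have "pos (f y + 1) < y" using val_left[of y] yr y fym by auto
    then show False using y(8)[OF pos_range[OF l(2)]] f_pos[OF l(2)] pos_range[OF l(2)] by auto
  qed
  have "f (y + 1) = N - y" if l: "y < N"
  proof (rule ccontr)
    assume ne: "f (y + 1) \<noteq> N - y"
    have y1: "y + 1 \<in> {1..N}" using l yr by auto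
    have "f (y + 1) < f 1" using y(8)[OF y1] range[OF y1] top by auto
    then have lt: "f (y + 1) < f 1 - 1" using ne top y(5) by auto
    then have r: "f 1 - 1 \<in> {1..N}" using range[OF y1] f1 by auto
    have "pos (f 1 - 1) < y"
      using baxter_inv[OF yr y1 pos_range[OF r]] f_pos[OF r] lt y(4,5,1) by auto
    then show False using y(8)[OF pos_range[OF r]] f_pos[OF r] pos_range[OF r] by auto
  qed
  moreover have "z \<le> y \<longleftrightarrow> f z > N - y" if "z \<in> {1..N}" for z
    using y(8)[OF that] range[OF that] that top y(5) by auto
  ultimately show ?thesis using y top ym by (intro exI[of _ y]) auto
qed

section \<open>Restricting and assembling\<close>

lemma da_baxter_cong:
  assumes "da_baxter \<delta> N f" "\<And>x. x \<in> {1..N} \<Longrightarrow> g x = f x"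
  shows "da_baxter \<delta> N g"
proof -
  interpret da_baxter \<delta> N f by (rule assms)
  show ?thesis
  proof
    show "\<delta> = 1 \<or> \<delta> = 3" "N > 0" "N mod 4 = 3" using phase size by auto
    show "bij_betw g {1..N} {1..N}" using bij bij_betw_cong[of "{1..N}" g f] assms(2) by auto
    show "even (g x) = even x" if "x \<in> {1..N}" for x using parity assms(2) that by auto
    show "if odd (g x) then g z < g x else g z > g y"
      if "x \<in> {1..N}" "y \<in> {1..N}" "g y = g x + 1" "min x y < z" "z < max x y" for x y z
    proof -
      have "z \<in> {1..N}" using that by (auto simp: min_def max_def split: if_splits)
      then show ?thesis using baxter[of x y z] that assms(2) by auto
    qed
    show "(g x < g (x + 2)) = (x mod 4 = \<delta>)" if "odd x" "1 \<le> x" "x + 2 \<le> N" for x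
      using alt[OF that] assms(2) that by auto
    show "(x < y) = (g x mod 4 = \<delta>)"
      if "x \<in> {1..N}" "y \<in> {1..N}" "odd (g x)" "g y = g x + 2" for x y
      using alt_inv[of x y] assms(2) that by auto
  qed
qed

lemma residue_shift:
  fixes z a \<delta> :: int
  assumes "\<delta> = 1 \<or> \<delta> = 3" "a mod 4 = 0 \<or> a mod 4 = 2"
  shows "((z + a) mod 4 = \<delta>) = (z mod 4 = (if a mod 4 = 0 then \<delta> else 4 - \<delta>))"
proof -
  have "(z + a) mod 4 = (z mod 4 + a mod 4) mod 4" by (simp add: mod_add_eq)
  moreover have "z mod 4 = 0 \<or> z mod 4 = 1 \<or> z mod 4 = 2 \<or> z mod 4 = 3" by presburger
  ultimately show ?thesis using assms by auto
qed

text \<open>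
  All conditions depend on relative order and on residues only: an even offset keeps the parities,
  and an offset of 2 modulo 4 exchanges the two phases.
\<close>

lemma da_baxter_restrict:
  assumes "da_baxter \<delta> N f" and ab: "even a" "a \<ge> 0" "b \<ge> 0" "a mod 4 = b mod 4"
    and n: "n > 0" "n mod 4 = 3" "a + n \<le> N"
    and img: "\<And>z. z \<in> {1..n} \<Longrightarrow> f (z + a) - b \<in> {1..n}"
  shows "da_baxter (if a mod 4 = 0 then \<delta> else 4 - \<delta>) n (\<lambda>z. f (z + a) - b)"
proof -
  interpret da_baxter \<delta> N f by (rule assms)
  let ?d = "if a mod 4 = 0 then \<delta> else 4 - \<delta>"
  have a4: "a mod 4 = 0 \<and> b mod 4 = 0 \<or> a mod 4 = 2 \<and> b mod 4 = 2" using ab(1,4) by presburger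
  have shift: "((z + c) mod 4 = \<delta>) = (z mod 4 = ?d)" if "c mod 4 = a mod 4" for z c
    using residue_shift[OF phase, of c z] a4 that by auto
  have evb: "even b" using a4 by presburger
  show ?thesis
  proof
    show "?d = 1 \<or> ?d = 3" using phase by auto
    show "n > 0" "n mod 4 = 3" using n by auto
    have "inj_on (\<lambda>z. f (z + a) - b) {1..n}"
    proof (rule inj_onI)
      fix y z assume "y \<in> {1..n}" "z \<in> {1..n}" "f (y + a) - b = f (z + a) - b"
      then show "y = z" using f_eq[of "y + a" "z + a"] ab n by auto
    qed
    moreover have "(\<lambda>z. f (z + a) - b) ` {1..n} \<subseteq> {1..n}" using img by blast
    ultimately show "bij_betw (\<lambda>z. f (z + a) - b) {1..n} {1..n}"
      unfolding bij_betw_def using endo_inj_surj[OF finite_atLeastAtMost_int] by blast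
    show "even (f (x + a) - b) = even x" if "x \<in> {1..n}" for x
      using parity[of "x + a"] that ab n evb by auto
    show "if odd (f (x + a) - b) then f (z + a) - b < f (x + a) - b else f (z + a) - b > f (y + a) - b"
      if "x \<in> {1..n}" "y \<in> {1..n}" "f (y + a) - b = f (x + a) - b + 1" "min x y < z" "z < max x y" for x y z
      using baxter[of "x + a" "y + a" "z + a"] that ab n evb by (auto simp: min_def max_def split: if_splits)
    show "(f (x + a) - b < f (x + 2 + a) - b) = (x mod 4 = ?d)" if "odd x" "1 \<le> x" "x + 2 \<le> n" for x
      using alt[of "x + a"] that ab n shift[OF refl, of x] by (simp add: add_ac)
    show "(x < y) = ((f (x + a) - b) mod 4 = ?d)"
      if "x \<in> {1..n}" "y \<in> {1..n}" "odd (f (x + a) - b)" "f (y + a) - b = f (x + a) - b + 2" for x y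
      using alt_inv[of "x + a" "y + a"] that ab n shift[OF ab(4)[symmetric], of "f (x + a) - b"] evb by simp
  qed
qed

lemma inj_endo_bij:
  fixes f :: "int \<Rightarrow> int"
  assumes "\<And>x. x \<in> {1..n} \<Longrightarrow> f x \<in> {1..n}" "\<And>x y. \<lbrakk>x \<in> {1..n}; y \<in> {1..n}; f x = f y\<rbrakk> \<Longrightarrow> x = y"
  shows "bij_betw f {1..n} {1..n}"
proof -
  have "inj_on f {1..n}" using assms(2) by (auto intro: inj_onI)
  moreover have "f ` {1..n} \<subseteq> {1..n}" using assms(1) by blast
  ultimately show ?thesis unfolding bij_betw_def using endo_inj_surj[OF finite_atLeastAtMost_int] by blast
qed

lemma da_baxter_123: "da_baxter 1 3 (\<lambda>x. x)"
proof
  show "(x < x + 2) = (x mod 4 = 1)" if "odd x" "1 \<le> x" "x + 2 \<le> 3" for x :: int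
  proof -
    have "x = 1" using that by linarith
    then show ?thesis by simp
  qed
  show "(x < y) = (x mod 4 = 1)" if "x \<in> {1..3}" "y \<in> {1..3}" "odd x" "y = x + 2" for x y :: int
  proof -
    have "x = 1" using that by auto
    then show ?thesis using that by simp
  qed
qed (auto simp: bij_betw_def min_def max_def split: if_splits)

text \<open>
  The direct sum \<open>12 \<oplus> g \<oplus> 12\<close>.  The offset 2 turns phase 3 into phase 1.
\<close>

lemma da_baxter_frame:
  assumes "da_baxter 3 n g"
    and f: "f 1 = 1" "f 2 = 2" "f (n + 3) = n + 3" "f (n + 4) = n + 4"
      "\<And>x. x \<in> {3..n + 2} \<Longrightarrow> f x = g (x - 2) + 2"
  shows "da_baxter 1 (n + 4) f"
proof -
  interpret da_baxter 3 n g by (rule assms)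
  have cases: "x = 1 \<or> x = 2 \<or> x = n + 3 \<or> x = n + 4 \<or> x \<in> {3..n+2}" if "x \<in> {1..n+4}" for x
    using that by auto
  have inner: "f x = g (x - 2) + 2" "g (x - 2) \<in> {1..n}" if "x \<in> {3..n+2}" for x
    using f(5) that range[of "x - 2"] by auto
  have n3: "n \<ge> 3" using size by presburger
  have oddn: "odd n" using size by presburger
  \<comment> \<open>The four outer positions carry the four outer values.\<close>
  have out: "f x \<le> 2 \<longleftrightarrow> x \<le> 2" "f x \<ge> n + 3 \<longleftrightarrow> x \<ge> n + 3" if "x \<in> {1..n+4}" for x
    using cases[OF that] inner[of x] f n3 by auto
  have outv: "f x = x" if "x \<in> {1..n+4}" "x \<le> 2 \<or> x \<ge> n + 3" for x
    using cases[OF that(1)] that f n3 by auto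
  have rng: "f x \<in> {1..n+4}" if "x \<in> {1..n+4}" for x
    using cases[OF that] inner[of x] f n3 by auto
  have inj: "x = y" if "x \<in> {1..n+4}" "y \<in> {1..n+4}" "f x = f y" for x y
  proof (cases "x \<le> 2 \<or> x \<ge> n + 3")
    case True
    then have "f x = x" using outv[OF that(1)] by blast
    moreover have "y \<le> 2 \<or> y \<ge> n + 3" using True out[OF that(1)] out[OF that(2)] that(3) by simp
    then have "f y = y" using outv[OF that(2)] by blast
    ultimately show ?thesis using that(3) by metis
  next
    case False
    then have "x \<in> {3..n+2}" "y \<in> {3..n+2}" using out[OF that(1)] out[OF that(2)] that by auto
    then show ?thesis using inner that(3) f_eq[of "x-2" "y-2"] by auto
  qed
  show ?thesis
  proof
    show "(1::int) = 1 \<or> (1::int) = 3" by simp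
    show "n + 4 > 0" "(n + 4) mod 4 = 3" using size by auto
    show "bij_betw f {1..n+4} {1..n+4}"
      by (rule inj_endo_bij) (use rng inj in blast)+
    show "even (f x) = even x" if "x \<in> {1..n+4}" for x
    proof (cases "x \<in> {3..n+2}")
      case True then show ?thesis using inner[OF True] parity[of "x-2"] by auto
    next
      case False then show ?thesis using outv[OF that] that by auto
    qed
  next
    fix x y z assume x: "x \<in> {1..n+4}" "y \<in> {1..n+4}" "f y = f x + 1" "min x y < z" "z < max x y"
    have z: "z \<in> {1..n+4}" "z \<noteq> x" "z \<noteq> y" using x by (auto simp: min_def max_def split: if_splits)
    have fz: "f z \<noteq> f x" "f z \<noteq> f y" using inj z x by blast+
    consider "x = 1" | "x = 2" | "x \<in> {3..n+2}" "y \<in> {3..n+2}" | "x \<in> {3..n+2}" "y = n + 3" | "x = n + 3"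
    proof -
      have "x \<noteq> n + 4" using rng[OF x(2)] x(3) f(4) by auto
      moreover have "y \<in> {3..n+2} \<or> y = n + 3" if xi: "x \<in> {3..n+2}"
      proof -
        have "f x \<in> {3..n+2}" using inner[OF xi] by auto
        then have "\<not> f y \<le> 2" "f y \<le> n + 3" using x(3) by auto
        moreover have "f y = y" if "y \<ge> n + 3" using outv[OF x(2)] that by blast
        ultimately show ?thesis using out(1)[OF x(2)] x(2) by fastforce
      qed
      ultimately show ?thesis using cases[OF x(1)] that by blast
    qed
    then show "if odd (f x) then f z < f x else f y < f z"
    proof cases
      case 1
      then have "y = 2" using x f inj[of y 2] n3 by auto
      then show ?thesis using 1 x by auto
    next
      case 2
      then have "f x = 2" "f y = 3" using f x by auto
      then have "z > 2" using 2 x out[OF x(2)] by (auto simp: min_def max_def split: if_splits)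
      then have "f z > 2" using out[OF z(1)] by auto
      then show ?thesis using \<open>f x = 2\<close> \<open>f y = 3\<close> fz by auto
    next
      case 3
      then have "z \<in> {3..n+2}" using x by (auto simp: min_def max_def split: if_splits)
      then show ?thesis using baxter[of "x-2" "y-2" "z-2"] inner 3 x
        by (auto simp: min_def max_def split: if_splits)
    next
      case 4
      then have "f x = n + 2" using x f by auto
      have "z \<in> {1..n+2}" using 4 x by (auto simp: min_def max_def split: if_splits)
      then have "f z < n + 3" using out[OF z(1)] by auto
      then have "f z < f x" using fz \<open>f x = n + 2\<close> by auto
      then show ?thesis using oddn \<open>f x = n + 2\<close> by auto
    next
      case 5
      then have "f y = n + 4" using x f by auto
      then have "y = n + 4" using x f inj[of y "n+4"] n3 by auto
      then show ?thesis using 5 x by auto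
    qed
  next
    fix x assume x: "odd x" "1 \<le> x" "x + 2 \<le> n + 4"
    consider "x = 1" | "x = n + 2" | "x \<in> {3..n}"
      using x oddn size by (smt (verit) atLeastAtMost_iff even_add odd_one one_add_one)
    then show "(f x < f (x + 2)) = (x mod 4 = 1)"
    proof cases
      case 1 then show ?thesis using inner[of 3] f n3 by auto
    next
      case 2
      have "(n + 2) mod 4 = 1" using size by presburger
      then show ?thesis using inner[of "n+2"] f n3 2 by (auto simp: add.assoc)
    next
      case 3
      have "((x - 2) mod 4 = 3) = (x mod 4 = 1)" by presburger
      then show ?thesis using inner[of x] inner[of "x+2"] alt[of "x-2"] 3 x by auto
    qed
  next
    fix x y assume x: "x \<in> {1..n+4}" "y \<in> {1..n+4}" "odd (f x)" "f y = f x + 2"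
    have "x \<noteq> 2" "x \<noteq> n + 3" using x f oddn by auto
    moreover have "x \<noteq> n + 4" using x f cases[OF x(2)] inner[of y] n3 by auto
    ultimately consider "x = 1" | "x \<in> {3..n+2}" using cases[OF x(1)] by blast
    then show "(x < y) = (f x mod 4 = 1)"
    proof cases
      case 1 then show ?thesis using f x by (cases "y = 1") auto
    next
      case 2
      show ?thesis
      proof (cases "y \<in> {3..n+2}")
        case True
        have "(g (x-2) mod 4 = 3) = ((g (x-2) + 2) mod 4 = 1)" by presburger
        then show ?thesis using alt_inv[of "x-2" "y-2"] x inner 2 True by auto
      next
        case False
        then have "f y = y" "y \<ge> n + 3" using outv[OF x(2)] x 2 inner[of x] out[OF x(2)] by auto
        then have "f x = n + 2 \<or> f x = n + 1" using out[OF x(1)] x 2 by auto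
        then have "f x = n + 2" using x(3) oddn by auto
        moreover have "(n + 2) mod 4 = 1" using size by presburger
        ultimately show ?thesis using 2 \<open>y \<ge> n+3\<close> by auto
      qed
    qed
  qed
qed

text \<open>
  The skew sum \<open>g \<ominus> 1 \<ominus> h\<close>.  That \<open>g\<close> starts with its minimum is needed for the pair of values formed
  by the separating entry and the minimum of the upper part: only larger values of that part may
  lie between them.
\<close>

lemma da_baxter_skew:
  assumes "da_baxter 1 L g" "da_baxter 1 M h" and g1: "g 1 = 1"
    and f: "\<And>x. x \<in> {1..L} \<Longrightarrow> f x = g x + M + 1" "f (L + 1) = M + 1"
      "\<And>x. x \<in> {L + 2..L + 1 + M} \<Longrightarrow> f x = h (x - L - 1)"
  shows "da_baxter 1 (L + 1 + M) f"
proof -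
  interpret g: da_baxter 1 L g by (rule assms)
  interpret h: da_baxter 1 M h by (rule assms)
  let ?N = "L + 1 + M"
  have pos: "L > 0" "M > 0" "odd L" "odd M" using g.size h.size by presburger+
  have left: "f x = g x + M + 1" "g x \<in> {1..L}" if "x \<in> {1..L}" for x
    using f(1) g.range that by auto
  have right: "f x = h (x - L - 1)" "h (x - L - 1) \<in> {1..M}" if "x \<in> {L+2..?N}" for x
    using f(3) h.range[of "x - L - 1"] that by auto
  have cases: "x \<in> {1..L} \<or> x = L + 1 \<or> x \<in> {L+2..?N}" if "x \<in> {1..?N}" for x using that by auto
  have side: "x \<le> L \<longleftrightarrow> f x > M + 1" "x > L + 1 \<longleftrightarrow> f x < M + 1" if "x \<in> {1..?N}" for x
    using cases[OF that] left[of x] right[of x] f(2) by auto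
  have inj: "x = y" if xy: "x \<in> {1..?N}" "y \<in> {1..?N}" "f x = f y" for x y
  proof -
    consider "x \<in> {1..L}" "y \<in> {1..L}" | "x = L+1" "y = L+1" | "x \<in> {L+2..?N}" "y \<in> {L+2..?N}"
      using cases[OF xy(1)] side[OF xy(1)] side[OF xy(2)] xy by auto
    then show ?thesis
    proof cases
      case 1 then show ?thesis using left xy(3) g.f_eq[of x y] by auto
    next
      case 2 then show ?thesis by auto
    next
      case 3 then show ?thesis using right xy(3) h.f_eq[of "x-L-1" "y-L-1"] by auto
    qed
  qed
  have f1: "f 1 = M + 2" using f(1)[of 1] g1 pos by auto
  have one: "1 \<in> {1..?N}" using pos by auto
  have mid: "L + 1 \<in> {1..?N}" using pos by auto
  show ?thesis
  proof
    show "(1::int) = 1 \<or> (1::int) = 3" by simp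
    show "?N > 0" "?N mod 4 = 3" using g.size h.size by presburger+
    show "bij_betw f {1..?N} {1..?N}"
    proof (rule inj_endo_bij)
      show "f x \<in> {1..?N}" if "x \<in> {1..?N}" for x
        using cases[OF that] left[of x] right[of x] f(2) pos by auto
    qed (use inj in blast)
    show "even (f x) = even x" if "x \<in> {1..?N}" for x
      using cases[OF that] left[of x] right[of x] f(2) pos g.parity[of x] h.parity[of "x-L-1"] by auto
  next
    fix x y z assume x: "x \<in> {1..?N}" "y \<in> {1..?N}" "f y = f x + 1" "min x y < z" "z < max x y"
    have z: "z \<in> {1..?N}" "z \<noteq> x" "z \<noteq> y" using x by (auto simp: min_def max_def split: if_splits)
    have fz: "f z \<noteq> f x" "f z \<noteq> f y" using inj z x by blast+
    consider "x \<in> {1..L}" "y \<in> {1..L}" | "x = L + 1" | "x \<in> {L+2..?N}" "y = L + 1" | "x \<in> {L+2..?N}" "y \<in> {L+2..?N}"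
      using cases[OF x(1)] cases[OF x(2)] side[OF x(1)] side[OF x(2)] x(3) by force
    then show "if odd (f x) then f z < f x else f y < f z"
    proof cases
      case 1
      then have "z \<in> {1..L}" using x by (auto simp: min_def max_def split: if_splits)
      then have "f x = g x + M + 1" "f y = g y + M + 1" "f z = g z + M + 1" using left(1) 1 by blast+
      then show ?thesis using g.baxter[OF 1 _ x(4,5)] x(3) pos(4) by (cases "odd (g x)") simp_all
    next
      case 2
      then have "f x = M + 1" "f y = M + 2" using f(2) x by auto
      then have "y = 1" using inj[OF x(2) one] f1 by auto
      then have "z \<le> L" using 2 x by (auto simp: min_def max_def split: if_splits)
      then have "f z > M + 1" using side[OF z(1)] by auto
      then show ?thesis using \<open>f x = M + 1\<close> \<open>f y = M + 2\<close> fz pos by auto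
    next
      case 3
      then have "f x = M" using f(2) x by auto
      moreover have "z > L + 1" using 3 x by (auto simp: min_def max_def split: if_splits)
      then have "f z < M + 1" using side[OF z(1)] by auto
      ultimately show ?thesis using fz pos by auto
    next
      case 4
      then have "z \<in> {L+2..?N}" using x by (auto simp: min_def max_def split: if_splits)
      then show ?thesis using h.baxter[of "x-L-1" "y-L-1" "z-L-1"] right 4 x
        by (auto simp: min_def max_def split: if_splits)
    qed
  next
    fix x assume x: "odd x" "1 \<le> x" "x + 2 \<le> ?N"
    consider "x + 2 \<le> L" | "x = L" | "x \<ge> L + 2"
      using x(1) pos by (smt (verit) even_plus_one_iff)
    then show "(f x < f (x + 2)) = (x mod 4 = 1)"
    proof cases
      case 1 then show ?thesis using left[of x] left[of "x+2"] g.alt[of x] x by auto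
    next
      case 2
      then show ?thesis using left[of L] right[of "L+2"] g.size pos x by auto
    next
      case 3
      have "((x - L - 1) mod 4 = 1) = (x mod 4 = 1)" using g.size by presburger
      moreover have "x + 2 - L - 1 = x - L - 1 + 2" by simp
      moreover have "odd (x - L - 1)" using x pos by presburger
      ultimately show ?thesis using right[of x] right[of "x+2"] h.alt[of "x-L-1"] 3 x by auto
    qed
  next
    fix x y assume x: "x \<in> {1..?N}" "y \<in> {1..?N}" "odd (f x)" "f y = f x + 2"
    have "x \<noteq> L + 1" using f(2) x(3) pos by auto
    moreover have "y \<noteq> L + 1" using f(2) x(3,4) pos by auto
    ultimately consider "x \<in> {1..L}" "y \<in> {1..L}" | "x \<in> {L+2..?N}" "y \<in> {1..L}" | "x \<in> {L+2..?N}" "y \<in> {L+2..?N}"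
      using cases[OF x(1)] cases[OF x(2)] side[OF x(1)] side[OF x(2)] x(4) by force
    then show "(x < y) = (f x mod 4 = 1)"
    proof cases
      case 1
      have "((g x + M + 1) mod 4 = 1) = (g x mod 4 = 1)" using h.size by presburger
      then show ?thesis using g.alt_inv[of x y] 1 left x pos by auto
    next
      case 2
      then have "f x = M" using right[of x] left[of y] x(3,4) pos by (smt (verit) atLeastAtMost_iff even_plus_one_iff)
      then show ?thesis using 2 h.size by auto
    next
      case 3
      then show ?thesis using h.alt_inv[of "x-L-1" "y-L-1"] right x by auto
    qed
  qed
qed

section \<open>One-line notation as a function\<close>

text \<open>
  Meaningful for arguments in \<open>{1..length xs}\<close> only.
\<close>

definition val :: "nat list \<Rightarrow> int \<Rightarrow> int" where
  "val xs x = int (ent xs (nat x))"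

lemma val_int [simp]: "val xs (int i) = int (ent xs i)"
  by (simp add: val_def)

lemma ball_int: "(\<forall>x\<in>{1..int n}. P x) \<longleftrightarrow> (\<forall>i\<in>{1..n}. P (int i))"
proof -
  have "{1..int n} = int ` {1..n}" by (simp add: image_int_atLeastAtMost)
  then show ?thesis by simp
qed

lemma is_perm_iff: "is_perm xs \<longleftrightarrow> distinct xs \<and> set xs = {1..length xs}"
  by (auto simp: is_perm_def permutations_of_set_def)

lemma ent_image: "ent xs ` {1..length xs} = set xs"
proof -
  have "{1..length xs} = Suc ` {..<length xs}" by (simp add: image_Suc_lessThan)
  then have "ent xs ` {1..length xs} = (!) xs ` {..<length xs}" by (simp add: image_image ent_def)
  then show ?thesis by (auto simp: set_conv_nth)
qed

lemma inj_ent_iff: "inj_on (ent xs) {1..length xs} \<longleftrightarrow> distinct xs"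
proof -
  have "card (ent xs ` {1..length xs}) = card (set xs)" by (simp only: ent_image)
  then show ?thesis by (metis card_atLeastAtMost card_distinct diff_Suc_1 distinct_card eq_card_imp_inj_on
    finite_atLeastAtMost card_image)
qed

lemma is_perm_ent: "is_perm xs \<longleftrightarrow> bij_betw (ent xs) {1..length xs} {1..length xs}"
  unfolding is_perm_iff bij_betw_def inj_ent_iff ent_image by blast

lemma is_perm_val: "is_perm xs \<longleftrightarrow> bij_betw (val xs) {1..int (length xs)} {1..int (length xs)}"
proof -
  have i: "{1..int n} = int ` {1..n}" for n by (simp add: image_int_atLeastAtMost)
  have "inj_on (val xs) {1..int (length xs)} \<longleftrightarrow> inj_on (ent xs) {1..length xs}"
    unfolding i by (auto simp: inj_on_def)
  moreover have "val xs ` {1..int (length xs)} = int ` ent xs ` {1..length xs}"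
    unfolding i by (simp add: image_image)
  ultimately show ?thesis unfolding is_perm_ent bij_betw_def
    unfolding i by (simp add: inj_image_eq_iff)
qed

lemma ent_range: "\<lbrakk>is_perm xs; i \<in> {1..length xs}\<rbrakk> \<Longrightarrow> ent xs i \<in> {1..length xs}"
  unfolding is_perm_ent bij_betw_def by blast

lemma list_eq_entI:
  assumes "length xs = length ys" "\<And>i. i \<in> {1..length ys} \<Longrightarrow> ent xs i = ent ys i"
  shows "xs = ys"
proof (rule nth_equalityI)
  show "xs ! i = ys ! i" if "i < length xs" for i
    using assms(2)[of "Suc i"] assms(1) that by (simp add: ent_def)
qed (rule assms)

lemma list_eq_valI:
  assumes "length xs = length ys" "\<And>x. x \<in> {1..int (length ys)} \<Longrightarrow> val xs x = val ys x"
  shows "xs = ys"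
proof (rule list_eq_entI)
  show "ent xs i = ent ys i" if "i \<in> {1..length ys}" for i
    using assms(2)[of "int i"] that by simp
qed (rule assms)

lemma list_of_da_baxter:
  assumes "da_baxter \<delta> N g"
  obtains xs where "int (length xs) = N" "\<And>x. x \<in> {1..N} \<Longrightarrow> val xs x = g x" 
    "da_baxter \<delta> (int (length xs)) (val xs)"
proof -
  interpret da_baxter \<delta> N g by (rule assms)
  define xs where "xs = map (\<lambda>i. nat (g (int i))) [1..<Suc (nat N)]"
  have l: "int (length xs) = N" using size by (simp add: xs_def)
  have v: "val xs x = g x" if "x \<in> {1..N}" for x
  proof -
    have "nat x - 1 < nat N" using that by auto
    then have "xs ! (nat x - 1) = nat (g x)" using that by (simp add: xs_def del: upt_Suc)
    then show ?thesis using range[OF that] by (simp add: val_def ent_def)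
  qed
  show ?thesis using that[OF l v] da_baxter_cong[OF assms v] l by simp
qed

section \<open>The permutations induced on even and odd entries\<close>

text \<open>
  Closed forms for the standardization of the even, respectively odd, entries of a permutation.
\<close>

definition evens :: "nat list \<Rightarrow> nat list" where
  "evens xs = map (\<lambda>x. x div 2) (filter even xs)"

definition odds :: "nat list \<Rightarrow> nat list" where
  "odds xs = map (\<lambda>x. (x + 1) div 2) (filter odd xs)"

lemma induced_even: assumes "is_perm xs" shows "induced_on even xs = evens xs"
proof -
  have "card {y \<in> set (filter even xs). y \<le> x} = x div 2" if "x \<in> set (filter even xs)" for x
  proof -
    have "{y \<in> set (filter even xs). y \<le> x} = (\<lambda>k. 2 * k) ` {1..x div 2}"
      using assms that unfolding is_perm_iff by (auto simp: image_def elim!: evenE)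
    then show ?thesis by (simp add: card_image inj_on_def)
  qed
  then show ?thesis unfolding induced_on_def standardize_def evens_def by (intro map_cong refl)
qed

lemma induced_odd: assumes "is_perm xs" shows "induced_on odd xs = odds xs"
proof -
  have "card {y \<in> set (filter odd xs). y \<le> x} = (x + 1) div 2" if "x \<in> set (filter odd xs)" for x
  proof -
    have "{y \<in> set (filter odd xs). y \<le> x} = (\<lambda>k. 2 * k - 1) ` {1..(x + 1) div 2}"
    proof (intro equalityI subsetI)
      fix y assume y: "y \<in> {y \<in> set (filter odd xs). y \<le> x}"
      then have "y = 2 * ((y + 1) div 2) - 1" "(y + 1) div 2 \<in> {1..(x + 1) div 2}" by (auto elim!: oddE)
      then show "y \<in> (\<lambda>k. 2 * k - 1) ` {1..(x + 1) div 2}" by blast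
    next
      fix y assume "y \<in> (\<lambda>k. 2 * k - 1) ` {1..(x + 1) div 2}"
      then obtain k where k: "y = 2 * k - 1" "k \<ge> 1" "k \<le> (x + 1) div 2" by auto
      then have "odd y" "y \<ge> 1" "y \<le> x" by auto
      then show "y \<in> {y \<in> set (filter odd xs). y \<le> x}" using assms that unfolding is_perm_iff by auto
    qed
    moreover have "inj_on (\<lambda>k. 2 * k - 1) {1..(x + 1) div 2}" by (auto simp: inj_on_def)
    ultimately show ?thesis by (simp add: card_image)
  qed
  then show ?thesis unfolding induced_on_def standardize_def odds_def by (intro map_cong refl)
qed

lemma set_evens: "is_perm xs \<Longrightarrow> set (evens xs) = {1..length xs div 2}"
proof -
  assume "is_perm xs"
  then have "set (evens xs) = (\<lambda>x. x div 2) ` {x \<in> {1..length xs}. even x}"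
    unfolding evens_def is_perm_iff by auto
  moreover have "y \<in> (\<lambda>x. x div 2) ` {x \<in> {1..length xs}. even x}" if "y \<in> {1..length xs div 2}" for y
    using that by (intro image_eqI[of _ _ "2 * y"]) auto
  ultimately show ?thesis by (auto elim!: evenE)
qed

lemma set_odds: "is_perm xs \<Longrightarrow> set (odds xs) = {1..(length xs + 1) div 2}"
proof -
  assume "is_perm xs"
  then have "set (odds xs) = (\<lambda>x. (x + 1) div 2) ` {x \<in> {1..length xs}. odd x}"
    unfolding odds_def is_perm_iff by auto
  moreover have "y \<in> (\<lambda>x. (x + 1) div 2) ` {x \<in> {1..length xs}. odd x}" if "y \<in> {1..(length xs + 1) div 2}" for y
    using that by (intro image_eqI[of _ _ "2 * y - 1"]) auto
  ultimately show ?thesis by (auto elim!: oddE)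
qed

lemma distinct_evens: "is_perm xs \<Longrightarrow> distinct (evens xs)"
  unfolding evens_def is_perm_iff distinct_map by (auto simp: inj_on_def elim!: evenE)

lemma distinct_odds: "is_perm xs \<Longrightarrow> distinct (odds xs)"
  unfolding odds_def is_perm_iff distinct_map by (auto simp: inj_on_def elim!: oddE)

lemma is_perm_evens: 
  assumes "is_perm xs" shows "length (evens xs) = length xs div 2" "is_perm (evens xs)"
proof -
  show "length (evens xs) = length xs div 2"
    using distinct_card[OF distinct_evens[OF assms]] set_evens[OF assms] by simp
  then show "is_perm (evens xs)"
    using distinct_evens[OF assms] set_evens[OF assms] by (simp add: is_perm_iff)
qed

lemma is_perm_odds: 
  assumes "is_perm xs" shows "length (odds xs) = (length xs + 1) div 2" "is_perm (odds xs)"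
proof -
  show "length (odds xs) = (length xs + 1) div 2"
    using distinct_card[OF distinct_odds[OF assms]] set_odds[OF assms] by simp
  then show "is_perm (odds xs)"
    using distinct_odds[OF assms] set_odds[OF assms] by (simp add: is_perm_iff)
qed

lemma filter_odd_alternate:
  assumes "\<And>i. i < length xs \<Longrightarrow> odd (xs ! i) \<longleftrightarrow> even i"
  shows "filter odd xs = map (\<lambda>j. xs ! (2 * j)) [0..<(length xs + 1) div 2]"
  using assms
proof (induction xs rule: induct_list012)
  case 1 then show ?case by simp
next
  case (2 x) then show ?case by force
next
  case (3 x y zs)
  have xy: "odd x" "even y" using "3.prems"[of 0] "3.prems"[of 1] by auto
  have "odd (zs ! i) \<longleftrightarrow> even i" if "i < length zs" for i
    using "3.prems"[of "i + 2"] that by simp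
  then have "filter odd zs = map (\<lambda>j. zs ! (2 * j)) [0..<(length zs + 1) div 2]" by (rule "3.IH"(1))
  moreover have "[0..<(length (x # y # zs) + 1) div 2] = 0 # map Suc [0..<(length zs + 1) div 2]"
    by (simp add: map_Suc_upt upt_conv_Cons del: upt_Suc)
  ultimately show ?case using xy by (simp add: comp_def)
qed

lemma ent_odds:
  assumes "\<forall>i\<in>{1..length xs}. even (ent xs i) \<longleftrightarrow> even i" "j \<in> {1..(length xs + 1) div 2}"
  shows "ent (odds xs) j = (ent xs (2 * j - 1) + 1) div 2"
proof -
  have "odd (xs ! i) \<longleftrightarrow> even i" if "i < length xs" for i
    using bspec[OF assms(1), of "Suc i"] that by (simp add: ent_def)
  from filter_odd_alternate[OF this]
  have f: "filter odd xs = map (\<lambda>j. xs ! (2 * j)) [0..<(length xs + 1) div 2]" by simp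
  have "j - 1 < (length xs + 1) div 2" using assms(2) by auto
  moreover have "2 * (j - 1) = 2 * j - 1 - 1" by simp
  ultimately show ?thesis unfolding odds_def f by (simp add: ent_def)
qed

lemma ent_perm_inverse:
  assumes "is_perm xs" "i \<in> {1..length xs}"
  shows "ent (perm_inverse xs) (ent xs i) = i"
proof -
  have r: "ent xs i \<in> {1..length xs}" by (rule ent_range[OF assms])
  have inj: "inj_on (ent xs) {1..length xs}" using assms(1) by (simp add: is_perm_ent bij_betw_def)
  have "(THE j. 1 \<le> j \<and> j \<le> length xs \<and> ent xs j = ent xs i) = i"
    using assms(2) inj_onD[OF inj] by (intro the_equality) auto
  moreover have "ent (perm_inverse xs) (ent xs i) = (THE j. 1 \<le> j \<and> j \<le> length xs \<and> ent xs j = ent xs i)"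
  proof -
    have "ent xs i - 1 < length xs" "1 + (ent xs i - 1) = ent xs i" using r by auto
    then show ?thesis unfolding perm_inverse_def
      by (subst ent_def) (simp add: nth_map del: upt_Suc)
  qed
  ultimately show ?thesis by simp
qed

lemma length_perm_inverse [simp]: "length (perm_inverse xs) = length xs"
  by (simp add: perm_inverse_def del: upt_Suc)

lemma perm_ent_surj:
  assumes "is_perm xs" "u \<in> {1..length xs}"
  obtains i where "i \<in> {1..length xs}" "ent xs i = u"
  using assms unfolding is_perm_ent bij_betw_def by (metis imageE)

section \<open>Complete Baxter permutations with doubly alternating odd entries\<close>

text \<open>
  Length 3 modulo 4 means an even number of odd entries.  The \<open>j\<close>-th odd entry sits at position
  \<open>2 j - 1\<close>, which is 1 modulo 4 iff \<open>j\<close> is odd; so the phase of the locale is 1.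
\<close>

lemma complete_baxter_iff_da_baxter:
  assumes len: "length \<pi> mod 4 = 3"
  shows "complete_baxter \<pi> \<and> doubly_alternating (induced_on odd \<pi>) \<longleftrightarrow>
    da_baxter 1 (int (length \<pi>)) (val \<pi>)"
proof -
  define n where "n = length \<pi>"
  define m where "m = (n + 1) div 2"
  have nm: "n + 1 = 2 * m" using len unfolding m_def n_def by presburger
  have n4: "int n mod 4 = 3" "int n > 0" using len unfolding n_def by presburger+
  show ?thesis
  proof (cases "is_perm \<pi> \<and> (\<forall>i\<in>{1..n}. even (ent \<pi> i) \<longleftrightarrow> even i)")
    case False
    moreover have "is_perm \<pi> \<and> (\<forall>i\<in>{1..n}. even (ent \<pi> i) \<longleftrightarrow> even i)" if "da_baxter 1 (int (length \<pi>)) (val \<pi>)"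
    proof -
      interpret da_baxter 1 "int n" "val \<pi>" using that unfolding n_def .
      have "\<forall>x\<in>{1..int n}. even (val \<pi> x) \<longleftrightarrow> even x" using parity by blast
      then show ?thesis using bij unfolding ball_int is_perm_val n_def by simp
    qed
    ultimately show ?thesis unfolding complete_baxter_def n_def by blast
  next
    case True
    then have perm: "is_perm \<pi>" and par: "\<And>i. i\<in>{1..n} \<Longrightarrow> even (ent \<pi> i) \<longleftrightarrow> even i" by auto
    let ?O = "odds \<pi>"
    have O: "induced_on odd \<pi> = ?O" "length ?O = m" "is_perm ?O"
      using induced_odd[OF perm] is_perm_odds[OF perm] unfolding m_def n_def by auto
    have entO: "2 * ent ?O j - 1 = ent \<pi> (2 * j - 1)" "2 * ent ?O j = ent \<pi> (2 * j - 1) + 1"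
      "ent ?O j \<in> {1..m}" if "j \<in> {1..m}" for j
    proof -
      have e: "ent ?O j = (ent \<pi> (2 * j - 1) + 1) div 2"
        using ent_odds[of \<pi> j] True that unfolding n_def m_def by blast
      have "2 * j - 1 \<in> {1..n}" "odd (2 * j - 1)" using that nm by auto
      then have "odd (ent \<pi> (2 * j - 1))" using par by blast
      then show "2 * ent ?O j - 1 = ent \<pi> (2 * j - 1)" "2 * ent ?O j = ent \<pi> (2 * j - 1) + 1"
        unfolding e by (auto elim!: oddE)
      show "ent ?O j \<in> {1..m}" using ent_range[OF O(3)] O(2) that by auto
    qed
    let ?I = "perm_inverse ?O"
    have entI: "ent ?I (ent ?O j) = j" if "j \<in> {1..m}" for j
      using ent_perm_inverse[OF O(3)] that O(2) by simp
    \<comment> \<open>A position between two positive ones is positive, so it makes no difference over which type \<open>z\<close> ranges.\<close>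
    have Bx: "(\<forall>x\<in>{1..n}. \<forall>y\<in>{1..n}. \<forall>z i.
        ent \<pi> x = i \<and> ent \<pi> y = i + 1 \<and> min x y < z \<and> z < max x y \<longrightarrow>
          (if odd i then ent \<pi> z < i else ent \<pi> z > i + 1)) \<longleftrightarrow>
      (\<forall>x\<in>{1..int n}. \<forall>y\<in>{1..int n}. \<forall>z. val \<pi> y = val \<pi> x + 1 \<longrightarrow> min x y < z \<longrightarrow> z < max x y \<longrightarrow>
          (if odd (val \<pi> x) then val \<pi> z < val \<pi> x else val \<pi> z > val \<pi> y))" (is "?A \<longleftrightarrow> ?B")
    proof
      assume A: ?A
      show ?B unfolding ball_int
      proof (intro ballI allI impI)
        fix x y :: nat and z :: int
        assume xy: "x \<in> {1..n}" "y \<in> {1..n}" "val \<pi> (int y) = val \<pi> (int x) + 1"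
          "min (int x) (int y) < z" "z < max (int x) (int y)"
        define k where "k = nat z"
        have k: "z = int k" using xy unfolding k_def by (auto simp: min_def split: if_splits)
        have e: "ent \<pi> y = ent \<pi> x + 1" "min x y < k" "k < max x y" using xy unfolding k
          by (auto simp: min_def max_def split: if_splits)
        then have "if odd (ent \<pi> x) then ent \<pi> k < ent \<pi> x else ent \<pi> k > ent \<pi> x + 1"
          using A xy(1,2) by blast
        then show "if odd (val \<pi> (int x)) then val \<pi> z < val \<pi> (int x) else val \<pi> z > val \<pi> (int y)"
          using e(1) unfolding k by (auto split: if_splits)
      qed
    next
      assume B: ?B
      show ?A
      proof (intro ballI allI impI)
        fix x y z i
        assume xy: "x \<in> {1..n}" "y \<in> {1..n}" "ent \<pi> x = i \<and> ent \<pi> y = i + 1 \<and> min x y < z \<and> z < max x y"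
        have "if odd (val \<pi> (int x)) then val \<pi> (int z) < val \<pi> (int x) else val \<pi> (int z) > val \<pi> (int y)"
          using B[unfolded ball_int, rule_format, OF xy(1,2), of "int z"] xy(3)
          by (auto simp: min_def max_def split: if_splits)
        then show "if odd i then ent \<pi> z < i else ent \<pi> z > i + 1" using xy(3) by (auto split: if_splits)
      qed
    qed
    have A1: "alternating ?O \<longleftrightarrow> (\<forall>x. odd x \<longrightarrow> 1 \<le> x \<longrightarrow> x + 2 \<le> int n \<longrightarrow>
       (val \<pi> x < val \<pi> (x + 2)) = (x mod 4 = 1))" (is "?A \<longleftrightarrow> ?B")
    proof -
      have step: "(if odd i then ent ?O i < ent ?O (i + 1) else ent ?O i > ent ?O (i + 1)) \<longleftrightarrow>
        (val \<pi> (2 * int i - 1) < val \<pi> (2 * int i - 1 + 2)) = ((2 * int i - 1) mod 4 = 1)"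
        if i: "1 \<le> i" "i < m" for i
      proof -
        have v: "val \<pi> (2 * int i - 1) = 2 * int (ent ?O i) - 1"
          "val \<pi> (2 * int i - 1 + 2) = 2 * int (ent ?O (i + 1)) - 1"
        proof -
          have "2 * int i - 1 = int (2 * i - 1)" "2 * int i - 1 + 2 = int (2 * (i + 1) - 1)" using i by auto
          note this[THEN arg_cong, of "val \<pi>", unfolded val_int]
          then show "val \<pi> (2 * int i - 1) = 2 * int (ent ?O i) - 1"
            "val \<pi> (2 * int i - 1 + 2) = 2 * int (ent ?O (i + 1)) - 1"
            using entO(2)[of i] entO(2)[of "i+1"] i by auto
        qed
        have "ent ?O i \<noteq> ent ?O (i + 1)" using entI[of i] entI[of "i+1"] i by auto
        moreover have "((2 * int i - 1) mod 4 = 1) = odd i" by presburger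
        ultimately show ?thesis unfolding v by auto
      qed
      have "?B \<longleftrightarrow> (\<forall>i. 1 \<le> i \<and> i < m \<longrightarrow>
        (val \<pi> (2 * int i - 1) < val \<pi> (2 * int i - 1 + 2)) = ((2 * int i - 1) mod 4 = 1))"
      proof (rule iffI; intro allI impI)
        fix i assume B: ?B and i: "1 \<le> i \<and> i < m"
        have "odd (2 * int i - 1)" "1 \<le> 2 * int i - 1" "2 * int i - 1 + 2 \<le> int n" using i nm by auto
        then show "(val \<pi> (2 * int i - 1) < val \<pi> (2 * int i - 1 + 2)) = ((2 * int i - 1) mod 4 = 1)"
          using B by blast
      next
        fix x assume h: "\<forall>i. 1 \<le> i \<and> i < m \<longrightarrow>
          (val \<pi> (2 * int i - 1) < val \<pi> (2 * int i - 1 + 2)) = ((2 * int i - 1) mod 4 = 1)"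
          and x: "odd x" "1 \<le> x" "x + 2 \<le> int n"
        obtain i where i: "x = 2 * int i - 1"
        proof
          show "x = 2 * int (nat ((x + 1) div 2)) - 1" using x by (auto elim!: oddE)
        qed
        have "1 \<le> i \<and> i < m" using i x nm by auto
        then show "(val \<pi> x < val \<pi> (x + 2)) = (x mod 4 = 1)" using h unfolding i by blast
      qed
      then show ?thesis unfolding alternating_def O(2) using step by auto
    qed
    have A2: "alternating ?I \<longleftrightarrow> (\<forall>x\<in>{1..int n}. \<forall>y\<in>{1..int n}. odd (val \<pi> x) \<longrightarrow>
      val \<pi> y = val \<pi> x + 2 \<longrightarrow> (x < y) = (val \<pi> x mod 4 = 1))" (is "?A \<longleftrightarrow> ?B")
    proof -
      \<comment> \<open>\<open>2 * j - 1\<close> is the position in \<open>\<pi>\<close> of the \<open>j\<close>-th odd entry, whose value there is \<open>2 * ent ?O j - 1\<close>.\<close>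
      have conv: "(int (2 * j - 1) < int (2 * j' - 1)) = (int (ent \<pi> (2 * j - 1)) mod 4 = 1) \<longleftrightarrow>
        (if odd (ent ?O j) then ent ?I (ent ?O j) < ent ?I (ent ?O j + 1) 
         else ent ?I (ent ?O j) > ent ?I (ent ?O j + 1))"
        if j: "j \<in> {1..m}" "j' \<in> {1..m}" "ent ?O j' = ent ?O j + 1" for j j'
      proof -
        have i: "ent ?I (ent ?O j) = j" "ent ?I (ent ?O j + 1) = j'"
          using entI[OF j(1)] entI[OF j(2)] unfolding j(3) by blast+
        have e: "int (ent \<pi> (2 * j - 1)) = 2 * int (ent ?O j) - 1" using entO(2)[OF j(1)] by simp
        have "(int (ent \<pi> (2 * j - 1)) mod 4 = 1) = odd (ent ?O j)" unfolding e by presburger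
        moreover have "j \<noteq> j'" using j by auto
        moreover have "(int (2 * j - 1) < int (2 * j' - 1)) = (j < j')" using j by auto
        ultimately show ?thesis unfolding i by auto
      qed
      show ?thesis
      proof
        assume A: ?A
        show ?B unfolding ball_int
        proof (intro ballI impI)
          fix x y assume x: "x \<in> {1..n}" "y \<in> {1..n}" "odd (val \<pi> (int x))" "val \<pi> (int y) = val \<pi> (int x) + 2"
          then have e: "odd (ent \<pi> x)" "ent \<pi> y = ent \<pi> x + 2" by auto
          then have "odd (ent \<pi> y)" by simp
          then have "odd x" "odd y" using par[OF x(1)] par[OF x(2)] e(1) by auto
          note this e(2)
          then obtain j j' where j: "x = 2 * j - 1" "y = 2 * j' - 1" "j \<in> {1..m}" "j' \<in> {1..m}"
          proof -
            have "x = 2 * ((x+1) div 2) - 1" "y = 2 * ((y+1) div 2) - 1" using \<open>odd x\<close> \<open>odd y\<close> by (auto elim!: oddE)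
            moreover have "(x+1) div 2 \<in> {1..m}" "(y+1) div 2 \<in> {1..m}" using x(1,2) nm by auto
            ultimately show ?thesis using that by blast
          qed
          have s: "ent ?O j' = ent ?O j + 1" using entO(2)[OF j(3)] entO(2)[OF j(4)] \<open>ent \<pi> y = ent \<pi> x + 2\<close> j(1,2) by simp
          have "1 \<le> ent ?O j" "ent ?O j < m" using entO(3)[OF j(3)] entO(3)[OF j(4)] s by auto
          then have "if odd (ent ?O j) then ent ?I (ent ?O j) < ent ?I (ent ?O j + 1) 
             else ent ?I (ent ?O j) > ent ?I (ent ?O j + 1)"
            using A unfolding alternating_def length_perm_inverse O(2) by blast
          then show "(int x < int y) = (val \<pi> (int x) mod 4 = 1)"
            using conv[OF j(3,4) s] unfolding val_int j(1,2) by blast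
        qed
      next
        assume B: ?B
        show ?A unfolding alternating_def length_perm_inverse O(2)
        proof (intro allI impI)
          fix i assume i: "1 \<le> i \<and> i < m"
          have im: "i \<in> {1..m}" "i + 1 \<in> {1..m}" using i by auto
          obtain j where "j \<in> {1..m}" "ent ?O j = i"
            using perm_ent_surj[OF O(3), unfolded O(2), OF im(1)] by blast
          moreover obtain j' where "j' \<in> {1..m}" "ent ?O j' = i + 1"
            using perm_ent_surj[OF O(3), unfolded O(2), OF im(2)] by blast
          ultimately have j: "j \<in> {1..m}" "ent ?O j = i" "j' \<in> {1..m}" "ent ?O j' = i + 1" by blast+
          have r: "2 * j - 1 \<in> {1..n}" "2 * j' - 1 \<in> {1..n}" using j nm by auto
          have e: "ent \<pi> (2 * j - 1) = 2 * i - 1" "ent \<pi> (2 * j' - 1) = 2 * i + 1"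
            using entO(1)[OF j(1)] entO(1)[OF j(3)] j by auto
          have "odd (val \<pi> (int (2 * j - 1)))" "val \<pi> (int (2 * j' - 1)) = val \<pi> (int (2 * j - 1)) + 2"
            using e i unfolding val_int by auto
          then have "(int (2 * j - 1) < int (2 * j' - 1)) = (val \<pi> (int (2 * j - 1)) mod 4 = 1)"
            using B[unfolded ball_int] r by blast
          then show "if odd i then ent ?I i < ent ?I (i + 1) else ent ?I i > ent ?I (i + 1)"
            using conv[OF j(1,3) j(4)[folded j(2)], unfolded j(2)] unfolding val_int by blast
        qed
      qed
    qed
    have pv: "\<forall>x\<in>{1..int n}. even (val \<pi> x) \<longleftrightarrow> even x" unfolding ball_int using par by simp
    have bij: "bij_betw (val \<pi>) {1..int n} {1..int n}" using perm unfolding is_perm_val n_def .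
    have on: "odd n" using nm by presburger
    show ?thesis
      unfolding complete_baxter_def doubly_alternating_def O(1) A1 A2
      unfolding n_def[symmetric] Bx
    proof (rule iffI, goal_cases)
      case 1
      show ?case
        by unfold_locales (use 1 pv bij n4 in blast)+
    next
      case 2
      interpret da_baxter 1 "int n" "val \<pi>" by (rule 2)
      show ?case
        using baxter alt alt_inv perm par on by blast
    qed
  qed
qed

section \<open>Sums and complements\<close>

definition direct_sum :: "nat list \<Rightarrow> nat list \<Rightarrow> nat list" (infixr "\<oplus>" 65) where
  "\<pi> \<oplus> \<sigma> = \<pi> @ map (\<lambda>x. length \<pi> + x) \<sigma>"

definition compl :: "nat list \<Rightarrow> nat list" where
  "compl \<pi> = map (\<lambda>x. length \<pi> + 1 - x) \<pi>"

text \<open>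
  For \<open>k = 2\<close> this is the outer block of a complete Baxter permutation, for \<open>k = 1\<close> that of a snow leopard
  permutation and of an odd thread.
\<close>

definition wrap :: "nat \<Rightarrow> nat list \<Rightarrow> nat list" where
  "wrap k \<pi> = incr_perm k \<oplus> compl \<pi> \<oplus> incr_perm k"

lemma length_ops [simp]:
  "length (\<pi> \<oplus> \<sigma>) = length \<pi> + length \<sigma>"
  "length (\<pi> \<ominus> \<sigma>) = length \<pi> + length \<sigma>"
  "length (compl \<pi>) = length \<pi>"
  "length (incr_perm k) = k"
  "length (wrap k \<pi>) = 2 * k + length \<pi>"
  by (simp_all add: direct_sum_def skew_sum_def compl_def incr_perm_def wrap_def del: upt_Suc)

lemma skew_sum_Nil [simp]: "\<pi> \<ominus> [] = \<pi>" "[] \<ominus> \<pi> = \<pi>"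
  by (simp_all add: skew_sum_def)

lemma incr_perm_1 [simp]: "incr_perm 1 = [1]" "incr_perm (Suc 0) = [1]" "incr_perm 0 = []"
  and incr_perm_2 [simp]: "incr_perm 2 = [1, 2]"
  and incr_perm_3: "incr_perm 3 = [1, 2, 3]"
  by (simp_all add: incr_perm_def numeral_eq_Suc)

lemma is_perm_incr [simp]: "is_perm (incr_perm k)"
  unfolding is_perm_iff incr_perm_def by auto

lemma is_perm_compl: "is_perm \<pi> \<Longrightarrow> is_perm (compl \<pi>)"
proof -
  assume p: "is_perm \<pi>"
  have "inj_on (\<lambda>x. length \<pi> + 1 - x) {1..length \<pi>}" by (auto simp: inj_on_def)
  moreover have "(\<lambda>x. length \<pi> + 1 - x) ` {1..length \<pi>} = {1..length \<pi>}"
  proof (rule endo_inj_surj)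
    show "inj_on (\<lambda>x. length \<pi> + 1 - x) {1..length \<pi>}" by (auto simp: inj_on_def)
  qed auto
  ultimately show ?thesis using p unfolding is_perm_iff compl_def by (simp add: distinct_map)
qed

lemma is_perm_direct_sum: "is_perm \<pi> \<Longrightarrow> is_perm \<sigma> \<Longrightarrow> is_perm (\<pi> \<oplus> \<sigma>)"
proof -
  assume p: "is_perm \<pi>" "is_perm \<sigma>"
  have "(\<lambda>x. length \<pi> + x) ` {1..length \<sigma>} = {length \<pi> + 1..length \<pi> + length \<sigma>}"
    by (simp add: image_add_atLeastAtMost[where 'a=nat])
  then show ?thesis using p unfolding is_perm_iff direct_sum_def by (auto simp: distinct_map inj_on_def)
qed

lemma is_perm_skew_sum: "is_perm \<pi> \<Longrightarrow> is_perm \<sigma> \<Longrightarrow> is_perm (\<pi> \<ominus> \<sigma>)"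
proof -
  assume p: "is_perm \<pi>" "is_perm \<sigma>"
  have "(\<lambda>x. length \<sigma> + x) ` {1..length \<pi>} = {length \<sigma> + 1..length \<sigma> + length \<pi>}"
    by (simp add: image_add_atLeastAtMost[where 'a=nat])
  then show ?thesis using p unfolding is_perm_iff skew_sum_def by (auto simp: distinct_map inj_on_def)
qed

lemma is_perm_wrap: "is_perm \<pi> \<Longrightarrow> is_perm (wrap k \<pi>)"
  unfolding wrap_def by (intro is_perm_direct_sum is_perm_compl is_perm_incr)

lemma compl_compl: "is_perm \<pi> \<Longrightarrow> compl (compl \<pi>) = \<pi>"
proof -
  assume p: "is_perm \<pi>"
  have "map ((\<lambda>x. length \<pi> + 1 - x) \<circ> (\<lambda>x. length \<pi> + 1 - x)) \<pi> = map id \<pi>"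
    using p unfolding is_perm_iff by (intro map_cong) auto
  then show ?thesis unfolding compl_def by simp
qed

lemma ent_append: "\<lbrakk>i \<ge> 1; i \<le> length xs + length ys\<rbrakk> \<Longrightarrow>
    ent (xs @ ys) i = (if i \<le> length xs then ent xs i else ent ys (i - length xs))"
  by (auto simp: ent_def nth_append)

lemma ent_map: "\<lbrakk>i \<ge> 1; i \<le> length xs\<rbrakk> \<Longrightarrow> ent (map g xs) i = g (ent xs i)"
  by (auto simp: ent_def)

lemma ent_direct_sum: "\<lbrakk>i \<ge> 1; i \<le> length \<pi> + length \<sigma>\<rbrakk> \<Longrightarrow>
    ent (\<pi> \<oplus> \<sigma>) i = (if i \<le> length \<pi> then ent \<pi> i else length \<pi> + ent \<sigma> (i - length \<pi>))"
  unfolding direct_sum_def by (simp add: ent_append ent_map)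

lemma ent_skew_sum: "\<lbrakk>i \<ge> 1; i \<le> length \<pi> + length \<sigma>\<rbrakk> \<Longrightarrow>
    ent (\<pi> \<ominus> \<sigma>) i = (if i \<le> length \<pi> then length \<sigma> + ent \<pi> i else ent \<sigma> (i - length \<pi>))"
  unfolding skew_sum_def by (simp add: ent_append ent_map)

lemma ent_compl: "\<lbrakk>i \<ge> 1; i \<le> length \<pi>\<rbrakk> \<Longrightarrow> ent (compl \<pi>) i = length \<pi> + 1 - ent \<pi> i"
  unfolding compl_def by (simp add: ent_map)

lemma ent_incr [simp]: "\<lbrakk>i \<ge> 1; i \<le> k\<rbrakk> \<Longrightarrow> ent (incr_perm k) i = i"
  unfolding incr_perm_def ent_def by (simp del: upt_Suc)

lemma val_skew_sum:
  assumes "x \<in> {1..int (length \<pi>) + int (length \<sigma>)}"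
  shows "val (\<pi> \<ominus> \<sigma>) x = (if x \<le> int (length \<pi>) then int (length \<sigma>) + val \<pi> x else val \<sigma> (x - int (length \<pi>)))"
proof -
  obtain i where "x = int i" using assms by (auto intro: that[of "nat x"])
  moreover have "nat (int i - int (length \<pi>)) = i - length \<pi>" by simp
  ultimately show ?thesis using assms ent_skew_sum[of i \<pi> \<sigma>] unfolding val_def by auto
qed

lemma ent_wrap:
  assumes "i \<ge> 1" "i \<le> 2 * k + length \<pi>" "is_perm \<pi>"
  shows "ent (wrap k \<pi>) i = (if i \<le> k \<or> i > k + length \<pi> then i else k + (length \<pi> + 1 - ent \<pi> (i - k)))"
proof -
  consider "i \<le> k" | "k < i" "i \<le> k + length \<pi>" | "i > k + length \<pi>" by linarith
  then show ?thesis
  proof cases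
    case 1 then show ?thesis using assms unfolding wrap_def by (simp add: ent_direct_sum)
  next
    case 2 then show ?thesis using assms unfolding wrap_def by (simp add: ent_direct_sum ent_compl)
  next
    case 3
    then have "\<not> i - k \<le> length \<pi>" "i - k \<ge> 1" by auto
    then show ?thesis using 3 assms unfolding wrap_def by (simp add: ent_direct_sum)
  qed
qed

lemma val_wrap:
  assumes "x \<in> {1..int (length \<pi>) + 2 * int k}" "is_perm \<pi>"
  shows "val (wrap k \<pi>) x = (if x \<le> int k \<or> x > int k + int (length \<pi>) then x
    else int (length \<pi>) + 1 - val \<pi> (x - int k) + int k)"
proof -
  obtain i where i: "x = int i" using assms by (auto intro: that[of "nat x"])
  show ?thesis
  proof (cases "i \<le> k \<or> i > k + length \<pi>")
    case True then show ?thesis using assms(1) ent_wrap[of i k \<pi>] assms(2) unfolding i by auto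
  next
    case False
    then have "ent \<pi> (i - k) \<in> {1..length \<pi>}" by (intro ent_range[OF assms(2)]) auto
    moreover have "int i - int k = int (i - k)" using False by simp
    then have "val \<pi> (int i - int k) = int (ent \<pi> (i - k))" by (metis val_int)
    ultimately show ?thesis using assms(1) ent_wrap[of i k \<pi>] assms(2) False unfolding i by auto
  qed
qed

section \<open>Complete Baxter permutations from binary trees\<close>

text \<open>
  \<open>Anti\<close> stands for the antipermutation.  It has no one-line notation: \<open>baxter_of Anti\<close> and the
  analogous values below are placeholders, and the case distinctions implement
  \<open>12 \<oplus> @ \<oplus> 12 = 123\<close>, \<open>1 \<oplus> @ \<oplus> 1 = 1\<close> and \<open>1 \<ominus> @ = \<emptyset>\<close>.
\<close>

datatype shape = Anti | Node shape shape

fun baxter_of :: "shape \<Rightarrow> nat list" where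
  "baxter_of Anti = []"
| "baxter_of (Node a b) = (if a = Anti then incr_perm 3 else wrap 2 (baxter_of a)) \<ominus> (if b = Anti then [] else [1] \<ominus> baxter_of b)"

abbreviation da_baxter_list :: "nat list \<Rightarrow> bool" where
  "da_baxter_list \<pi> \<equiv> da_baxter 1 (int (length \<pi>)) (val \<pi>)"

lemma da_baxter_list_perm: "da_baxter_list \<pi> \<Longrightarrow> is_perm \<pi>"
  unfolding is_perm_val by (rule da_baxter.bij)

lemma da_baxter_outer_block:
  assumes "a = Anti \<or> da_baxter_list (baxter_of a)"
  shows "da_baxter_list (if a = Anti then incr_perm 3 else wrap 2 (baxter_of a))"
    "val (if a = Anti then incr_perm 3 else wrap 2 (baxter_of a)) 1 = 1"
proof -
  have "da_baxter_list (if a = Anti then incr_perm 3 else wrap 2 (baxter_of a)) \<and>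
    val (if a = Anti then incr_perm 3 else wrap 2 (baxter_of a)) 1 = 1"
  proof (cases "a = Anti")
    case True
    have "da_baxter_list (incr_perm 3)"
    proof (rule da_baxter_cong)
      show "da_baxter 1 (int (length (incr_perm 3))) (\<lambda>x. x)" using da_baxter_123 by simp
      show "val (incr_perm 3) x = x" if "x \<in> {1..int (length (incr_perm 3))}" for x
        using that by (auto simp: val_def)
    qed
    moreover have "val (incr_perm 3) 1 = 1" by (simp add: val_def)
    ultimately show ?thesis using True by simp
  next
    case False
    then have d: "da_baxter_list (baxter_of a)" using assms by blast
    have p: "is_perm (baxter_of a)" by (rule da_baxter_list_perm[OF d])
    let ?n = "int (length (baxter_of a))"
    have "da_baxter 3 ?n (\<lambda>x. ?n + 1 - val (baxter_of a) x)" using da_baxter.complement[OF d] by simp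
    from da_baxter_frame[OF this, of "val (wrap 2 (baxter_of a))"]
    have "da_baxter 1 (?n + 4) (val (wrap 2 (baxter_of a)))" by (simp add: val_wrap[OF _ p])
    moreover have "val (wrap 2 (baxter_of a)) 1 = 1" by (subst val_wrap[OF _ p]) auto
    ultimately show ?thesis using False by (simp add: add.commute)
  qed
  then show "da_baxter_list (if a = Anti then incr_perm 3 else wrap 2 (baxter_of a))"
    "val (if a = Anti then incr_perm 3 else wrap 2 (baxter_of a)) 1 = 1" by blast+
qed

lemma da_baxter_baxter_of: "t \<noteq> Anti \<Longrightarrow> da_baxter_list (baxter_of t)"
proof (induction t)
  case Anti then show ?case by simp
next
  case (Node a b)
  define B where "B = (if a = Anti then incr_perm 3 else wrap 2 (baxter_of a))"
  have "a = Anti \<or> da_baxter_list (baxter_of a)" using Node.IH(1) by blast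
  note B = da_baxter_outer_block[OF this, folded B_def]
  show ?case
  proof (cases "b = Anti")
    case True then show ?thesis using B unfolding B_def by simp
  next
    case False
    let ?L = "int (length B)" and ?M = "int (length (baxter_of b))"
    have d: "da_baxter_list (baxter_of b)" using Node.IH(2) False by blast
    have e: "baxter_of (Node a b) = B \<ominus> ([1] \<ominus> baxter_of b)" using False unfolding B_def by simp
    have "da_baxter 1 (?L + 1 + ?M) (val (baxter_of (Node a b)))"
    proof (rule da_baxter_skew[OF B(1) d B(2)])
      show "val (baxter_of (Node a b)) x = val B x + ?M + 1" if "x \<in> {1..?L}" for x
        unfolding e using that by (subst val_skew_sum) auto
      show "val (baxter_of (Node a b)) (?L + 1) = ?M + 1"
        unfolding e by (simp add: val_skew_sum) (simp add: val_def ent_def)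
      show "val (baxter_of (Node a b)) x = val (baxter_of b) (x - ?L - 1)" if "x \<in> {?L + 2..?L + 1 + ?M}" for x
      proof -
        have "x - ?L \<in> {2..1 + ?M}" using that by auto
        then show ?thesis unfolding e using that by (simp add: val_skew_sum)
      qed
    qed
    moreover have "int (length (baxter_of (Node a b))) = ?L + 1 + ?M" unfolding e by simp
    ultimately show ?thesis by simp
  qed
qed

text \<open>
  The first block, without two entries at either end, is an interval at an offset 2 modulo 4; its
  complement satisfies the hypothesis again.  So does what remains after the block and the
  separating entry.
\<close>

lemma da_baxter_imp_baxter_of: "da_baxter_list \<pi> \<Longrightarrow> \<exists>t. t \<noteq> Anti \<and> \<pi> = baxter_of t"
proof (induction "length \<pi>" arbitrary: \<pi> rule: less_induct)
  case less
  let ?N = "int (length \<pi>)"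
  interpret da_baxter 1 ?N "val \<pi>" by (rule less.prems)
  obtain L where L: "3 \<le> L" "L \<le> ?N" "L mod 4 = 3" "val \<pi> 1 = ?N - L + 1" "val \<pi> 2 = ?N - L + 2"
    "val \<pi> (L - 1) = ?N - 1" "val \<pi> L = ?N"
    "\<And>z. z\<in>{1..?N} \<Longrightarrow> z \<le> L \<longleftrightarrow> val \<pi> z > ?N - L" "L < ?N \<Longrightarrow> val \<pi> (L + 1) = ?N - L"
    using da_baxter_first_block[OF less.prems] by blast
  have "\<exists>a. int (length (if a = Anti then incr_perm 3 else wrap 2 (baxter_of a))) = L \<and>
    (\<forall>x\<in>{1..L}. val \<pi> x = ?N - L + val (if a = Anti then incr_perm 3 else wrap 2 (baxter_of a)) x)"
  proof (cases "L = 3")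
    case True
    have "val \<pi> x = ?N - L + val (incr_perm 3) x" if "x \<in> {1..L}" for x
    proof -
      have "x = 1 \<or> x = 2 \<or> x = 3" using that True by auto
      moreover have "val (incr_perm 3) x = x" using that True by (auto simp: val_def)
      ultimately show ?thesis using L(4,5,7) True by auto
    qed
    then show ?thesis using True by (intro exI[of _ Anti]) simp
  next
    case False
    have L7: "L \<ge> 7" using L(1,3) False by presburger
    define n where "n = L - 4"
    define b where "b = ?N - L + 2"
    have n: "n > 0" "n mod 4 = 3" "2 + n \<le> ?N" using L7 L(2,3) unfolding n_def by presburger+
    have b: "b \<ge> 0" "2 mod 4 = b mod 4" using L(2,3) size unfolding b_def by presburger+
    have "val \<pi> (z + 2) - b \<in> {1..n}" if z: "z \<in> {1..n}" for z
    proof -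
      have r: "z + 2 \<in> {1..?N}" "1 \<in> {1..?N}" "2 \<in> {1..?N}" "L - 1 \<in> {1..?N}" "L \<in> {1..?N}"
        using z n L(1,2) unfolding n_def by auto
      have "z + 2 \<le> L" using z unfolding n_def by simp
      then have "val \<pi> (z + 2) > ?N - L" using L(8)[OF r(1)] by blast
      moreover have "val \<pi> (z + 2) \<noteq> val \<pi> 1" "val \<pi> (z + 2) \<noteq> val \<pi> 2"
          "val \<pi> (z + 2) \<noteq> val \<pi> (L - 1)" "val \<pi> (z + 2) \<noteq> val \<pi> L"
        using f_eq r z unfolding n_def by auto
      moreover have "val \<pi> (z + 2) \<le> ?N" using range[OF r(1)] by simp
      ultimately show ?thesis unfolding b_def n_def L(4-7) by auto
    qed
    \<comment> \<open>The inner interval has phase 3, its complement phase 1.\<close>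
    from da_baxter_restrict[OF less.prems _ _ b n this]
    have "da_baxter 3 n (\<lambda>z. val \<pi> (z + 2) - b)" by simp
    from da_baxter.complement[OF this]
    have "da_baxter 1 n (\<lambda>z. n + 1 - (val \<pi> (z + 2) - b))" by simp
    then obtain \<rho> where \<rho>: "int (length \<rho>) = n" "\<And>x. x \<in> {1..n} \<Longrightarrow> val \<rho> x = n + 1 - (val \<pi> (x + 2) - b)"
      "da_baxter_list \<rho>" by (rule list_of_da_baxter) blast
    then have "length \<rho> < length \<pi>" using n by linarith
    then obtain a where a: "a \<noteq> Anti" "\<rho> = baxter_of a" using less.hyps[OF _ \<rho>(3)] by blast
    have p: "is_perm \<rho>" by (rule da_baxter_list_perm[OF \<rho>(3)])
    have "val \<pi> x = ?N - L + val (wrap 2 \<rho>) x" if x: "x \<in> {1..L}" for x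
    proof -
      have w: "val (wrap 2 \<rho>) x = (if x \<le> 2 \<or> x > 2 + n then x else n + 1 - val \<rho> (x - 2) + 2)"
        using val_wrap[OF _ p, of x 2] x \<rho>(1) unfolding n_def by simp
      consider "x = 1" | "x = 2" | "x - 2 \<in> {1..n}" | "x = L - 1" | "x = L"
        using x unfolding n_def by fastforce
      then show ?thesis
      proof cases
        case 3
        then show ?thesis unfolding w using \<rho>(2)[OF 3] by (simp add: b_def)
      qed (use w L(4-7) L7 in \<open>simp_all add: n_def\<close>)
    qed
    then show ?thesis using a \<rho>(1) by (intro exI[of _ a]) (simp add: n_def)
  qed
  then obtain a B where B: "B = (if a = Anti then incr_perm 3 else wrap 2 (baxter_of a))" "int (length B) = L"
    "\<And>x. x \<in> {1..L} \<Longrightarrow> val \<pi> x = ?N - L + val B x" by blast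
  show ?case
  proof (cases "L = ?N")
    case True
    have "\<pi> = B" using B(2,3) True by (intro list_eq_valI) auto
    then have "\<pi> = baxter_of (Node a Anti)" using B(1) by simp
    then show ?thesis by blast
  next
    case False
    then have lt: "L < ?N" using L(2) by simp
    define M where "M = ?N - L - 1"
    have M: "M > 0" "M mod 4 = 3" "L + 1 + M \<le> ?N"
      using lt L(3) size(2) unfolding M_def by presburger+
    have L1: "even (L + 1)" "(L + 1) mod 4 = 0" using L(3) by presburger+
    have "val \<pi> (z + (L + 1)) - 0 \<in> {1..M}" if z: "z \<in> {1..M}" for z
    proof -
      have r: "z + (L + 1) \<in> {1..?N}" "L + 1 \<in> {1..?N}" using z M L(1) by auto
      have "\<not> z + (L + 1) \<le> L" using z by simp
      then have "val \<pi> (z + (L + 1)) \<le> ?N - L" using L(8)[OF r(1)] by linarith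
      moreover have "val \<pi> (z + (L + 1)) \<noteq> val \<pi> (L + 1)" using f_eq[OF r] z by simp
      moreover have "val \<pi> (z + (L + 1)) \<ge> 1" using range[OF r(1)] by simp
      ultimately show ?thesis using L(9)[OF lt] unfolding M_def by auto
    qed
    from da_baxter_restrict[OF less.prems L1(1) _ _ _ M this] L(1) L1(2)
    have "da_baxter 1 M (\<lambda>z. val \<pi> (z + (L + 1)))" by simp
    then obtain \<rho> where \<rho>: "int (length \<rho>) = M" "\<And>x. x \<in> {1..M} \<Longrightarrow> val \<rho> x = val \<pi> (x + (L + 1))"
      "da_baxter_list \<rho>" by (rule list_of_da_baxter) blast
    then have "length \<rho> < length \<pi>" using M L(1) by linarith
    then obtain b where b: "b \<noteq> Anti" "\<rho> = baxter_of b" using less.hyps[OF _ \<rho>(3)] by blast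
    have "\<pi> = B \<ominus> [1] \<ominus> \<rho>"
    proof (rule list_eq_valI)
      have "int (length \<pi>) = int (length (B \<ominus> [1] \<ominus> \<rho>))" using B(2) \<rho>(1) unfolding M_def by simp
      then show len: "length \<pi> = length (B \<ominus> [1] \<ominus> \<rho>)" by simp
      fix x assume "x \<in> {1..int (length (B \<ominus> [1] \<ominus> \<rho>))}"
      then have x: "x \<in> {1..?N}" using len by simp
      have sk: "val (B \<ominus> [1] \<ominus> \<rho>) x = (if x \<le> L then 1 + M + val B x else val ([1] \<ominus> \<rho>) (x - L))"
        using x B(2) \<rho>(1) by (subst val_skew_sum) (auto simp: M_def)
      consider "x \<in> {1..L}" | "x = L + 1" | "x - L - 1 \<in> {1..M}" using x unfolding M_def by fastforce
      then show "val \<pi> x = val (B \<ominus> [1] \<ominus> \<rho>) x"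
      proof cases
        case 1 then show ?thesis using B(3)[OF 1] unfolding sk M_def by simp
      next
        case 2
        have "val ([1] \<ominus> \<rho>) 1 = M + 1" using \<rho>(1) by (subst val_skew_sum) (auto simp: val_def ent_def)
        then show ?thesis using L(9)[OF lt] 2 unfolding sk by (simp add: M_def)
      next
        case 3
        have "val ([1] \<ominus> \<rho>) (x - L) = val \<rho> (x - L - 1)" using 3 \<rho>(1) by (subst val_skew_sum) auto
        then show ?thesis using \<rho>(2)[OF 3] 3 unfolding sk by simp
      qed
    qed
    then have "\<pi> = baxter_of (Node a b)" using B(1) b by simp
    then show ?thesis by blast
  qed
qed

lemma complete_baxter_iff_baxter_of:
  assumes "length \<pi> mod 4 = 3"
  shows "complete_baxter \<pi> \<and> doubly_alternating (induced_on odd \<pi>) \<longleftrightarrow> (\<exists>t. t \<noteq> Anti \<and> \<pi> = baxter_of t)"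
  using complete_baxter_iff_da_baxter[OF assms] da_baxter_baxter_of da_baxter_imp_baxter_of by metis

section \<open>Snow leopard permutations of odd length and their threads\<close>

fun leopard_of :: "shape \<Rightarrow> nat list" where
  "leopard_of Anti = []"
| "leopard_of (Node a b) = (if a = Anti then [1] else wrap 1 (leopard_of a)) \<ominus> (if b = Anti then [] else [1] \<ominus> leopard_of b)"

text \<open>
  Even and odd threads of \<open>leopard_of\<close>.  The two recursions are coupled because adding the initial
  entry 1 of the outer block exchanges the parities.  The value \<open>[]\<close> of \<open>odd_of Anti\<close> is genuine,
  as the odd part of the antipermutation is empty, whereas \<open>even_of Anti\<close> is a placeholder.
\<close>

fun even_of :: "shape \<Rightarrow> nat list" and odd_of :: "shape \<Rightarrow> nat list" where
  "even_of Anti = []"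
| "even_of (Node a b) = compl (odd_of a) \<ominus> (if b = Anti then [] else [1] \<ominus> even_of b)"
| "odd_of Anti = []"
| "odd_of (Node a b) = (if a = Anti then [1] else wrap 1 (even_of a)) \<ominus> odd_of b"

lemma evens_append: "evens (xs @ ys) = evens xs @ evens ys"
  and odds_append: "odds (xs @ ys) = odds xs @ odds ys"
  by (simp_all add: evens_def odds_def)

lemma evens_shift: "even c \<Longrightarrow> evens (map (\<lambda>x. c + x) xs) = map (\<lambda>x. c div 2 + x) (evens xs)"
  and odds_shift: "even c \<Longrightarrow> odds (map (\<lambda>x. c + x) xs) = map (\<lambda>x. c div 2 + x) (odds xs)"
  by (auto simp: evens_def odds_def filter_map comp_def elim!: evenE)

lemma shift_odd:
  assumes "odd c"
  shows "evens (map (\<lambda>x. c + x) xs) = map (\<lambda>x. c div 2 + x) (odds xs)"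
    "odds (map (\<lambda>x. c + x) xs) = map (\<lambda>x. (c + 1) div 2 + x) (evens xs)"
  using assms by (auto simp: evens_def odds_def filter_map comp_def elim!: oddE)

lemma skew_parts:
  assumes "is_perm ys" "even (length ys)"
  shows "evens (xs \<ominus> ys) = evens xs \<ominus> evens ys" "odds (xs \<ominus> ys) = odds xs \<ominus> odds ys"
  using assms is_perm_evens[OF assms(1)] is_perm_odds[OF assms(1)]
  unfolding skew_sum_def by (auto simp: evens_append odds_append evens_shift odds_shift)

lemma sep_parts:
  assumes "is_perm ys" "odd (length ys)"
  shows "evens ([1] \<ominus> ys) = [1] \<ominus> evens ys" "odds ([1] \<ominus> ys) = odds ys"
  using assms is_perm_evens[OF assms(1)]
  unfolding skew_sum_def by (auto simp: evens_def odds_def elim!: oddE)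

lemma compl_parts:
  assumes "is_perm xs" "odd (length xs)"
  shows "evens (compl xs) = compl (evens xs)" "odds (compl xs) = compl (odds xs)"
proof -
  let ?n = "length xs"
  have par: "even (?n + 1 - x) \<longleftrightarrow> even x" if "x \<in> set xs" for x
    using assms that unfolding is_perm_iff by auto
  have "filter even (map (\<lambda>x. ?n + 1 - x) xs) = map (\<lambda>x. ?n + 1 - x) (filter even xs)"
    unfolding filter_map comp_def by (rule arg_cong[OF filter_cong]) (use par in blast)+
  then have "evens (compl xs) = map (\<lambda>x. (?n + 1 - x) div 2) (filter even xs)"
    unfolding evens_def compl_def by (simp only: map_map comp_def)
  also have "\<dots> = map (\<lambda>x. length (evens xs) + 1 - x div 2) (filter even xs)"
    using assms is_perm_evens(1)[OF assms(1)] by (intro map_cong) (auto elim!: oddE evenE)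
  also have "\<dots> = compl (evens xs)" unfolding compl_def by (simp add: evens_def)
  finally show "evens (compl xs) = compl (evens xs)" .
  have "filter odd (map (\<lambda>x. ?n + 1 - x) xs) = map (\<lambda>x. ?n + 1 - x) (filter odd xs)"
    unfolding filter_map comp_def by (rule arg_cong[OF filter_cong]) (use par in blast)+
  then have "odds (compl xs) = map (\<lambda>x. (?n + 1 - x + 1) div 2) (filter odd xs)"
    unfolding odds_def compl_def by (simp only: map_map comp_def)
  also have "\<dots> = map (\<lambda>x. length (odds xs) + 1 - (x + 1) div 2) (filter odd xs)"
    using assms is_perm_odds(1)[OF assms(1)] unfolding is_perm_iff
    by (intro map_cong) (auto elim!: oddE evenE)
  also have "\<dots> = compl (odds xs)" unfolding compl_def by (simp add: odds_def)
  finally show "odds (compl xs) = compl (odds xs)" .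
qed

lemma wrap2_evens:
  assumes "is_perm xs" "odd (length xs)"
  shows "evens (wrap 2 xs) = wrap 1 (evens xs)"
proof -
  have w: "wrap 2 xs = [1, 2] @ map (\<lambda>x. 2 + x) (compl xs) @ [length xs + 3, length xs + 4]"
    by (simp add: wrap_def direct_sum_def)
  have w': "wrap 1 (evens xs) = [1] @ map (\<lambda>x. 1 + x) (compl (evens xs)) @ [length (evens xs) + 2]"
    by (simp add: wrap_def direct_sum_def)
  have "evens [1, 2] = [1]" "evens [length xs + 3, length xs + 4] = [length (evens xs) + 2]"
    using assms(2) is_perm_evens(1)[OF assms(1)] by (auto simp: evens_def elim!: oddE)
  then show ?thesis unfolding w w' evens_append evens_shift[OF even_numeral] compl_parts[OF assms] by simp
qed

lemma wrap1_parts: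
  assumes "is_perm xs" "odd (length xs)"
  shows "evens (wrap 1 xs) = compl (odds xs)" "odds (wrap 1 xs) = wrap 1 (evens xs)"
proof -
  have w: "wrap 1 xs = [1] @ map (\<lambda>x. 1 + x) (compl xs) @ [length xs + 2]"
    by (simp add: wrap_def direct_sum_def)
  have w': "wrap 1 (evens xs) = [1] @ map (\<lambda>x. 1 + x) (compl (evens xs)) @ [length (evens xs) + 2]"
    by (simp add: wrap_def direct_sum_def)
  show "evens (wrap 1 xs) = compl (odds xs)" unfolding w evens_append shift_odd(1)[OF odd_one] compl_parts[OF assms]
    using assms by (auto simp: evens_def map_idI)
  show "odds (wrap 1 xs) = wrap 1 (evens xs)" unfolding w w' odds_append shift_odd(2)[OF odd_one] compl_parts[OF assms]
    using assms is_perm_evens(1)[OF assms(1)] by (auto simp: odds_def elim!: oddE)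
qed

lemma baxter_of_props: "t \<noteq> Anti \<Longrightarrow> is_perm (baxter_of t) \<and> length (baxter_of t) mod 4 = 3"
proof -
  assume "t \<noteq> Anti"
  then have d: "da_baxter_list (baxter_of t)" by (rule da_baxter_baxter_of)
  have "int (length (baxter_of t)) mod 4 = 3" using da_baxter.size[OF d] by blast
  then show ?thesis using da_baxter_list_perm[OF d] by presburger
qed

lemma evens_123: "evens (incr_perm 3) = [1]"
  by (simp add: incr_perm_3 evens_def)

lemma evens_baxter_of: "t \<noteq> Anti \<Longrightarrow> evens (baxter_of t) = leopard_of t"
proof (induction t)
  case Anti then show ?case by simp
next
  case (Node a b)
  have odd3: "odd (n::nat)" if "n mod 4 = 3" for n using that by presburger
  have a: "evens (if a = Anti then incr_perm 3 else wrap 2 (baxter_of a)) = (if a = Anti then [1] else wrap 1 (leopard_of a))"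
    using Node.IH(1) wrap2_evens[of "baxter_of a"] baxter_of_props[of a] odd3 by (auto simp: evens_123)
  show ?case
  proof (cases "b = Anti")
    case True then show ?thesis using a by simp
  next
    case False
    have b: "is_perm (baxter_of b)" "odd (length (baxter_of b))" using baxter_of_props[OF False] odd3 by auto
    have "is_perm [1]" using is_perm_incr[of 1] by simp
    then have p: "is_perm ([1] \<ominus> baxter_of b)" by (rule is_perm_skew_sum[OF _ b(1)])
    have e: "even (length ([1] \<ominus> baxter_of b))" using b(2) by simp
    have "evens (baxter_of (Node a b)) =
       evens (if a = Anti then incr_perm 3 else wrap 2 (baxter_of a)) \<ominus> [1] \<ominus> evens (baxter_of b)"
      using False skew_parts(1)[OF p e] sep_parts(1)[OF b] by (simp del: length_ops)
    then show ?thesis using a Node.IH(2)[OF False] False by simp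
  qed
qed

lemma leopard_of_props: "t \<noteq> Anti \<Longrightarrow> is_perm (leopard_of t) \<and> odd (length (leopard_of t))"
proof -
  assume t: "t \<noteq> Anti"
  have "is_perm (leopard_of t)" "length (leopard_of t) = length (baxter_of t) div 2"
    using is_perm_evens[of "baxter_of t"] baxter_of_props[OF t] evens_baxter_of[OF t] by auto
  moreover have "length (baxter_of t) mod 4 = 3" using baxter_of_props[OF t] by blast
  ultimately show ?thesis by presburger
qed

text \<open>
  A snow leopard permutation of odd length \<open>n\<close> comes from a complete Baxter permutation of length
  \<open>2 n + 1\<close>, which is 3 modulo 4.
\<close>

lemma snow_leopard_odd_iff:
  "snow_leopard \<pi> \<and> odd (elength \<pi>) \<longleftrightarrow> \<pi> = Antiperm \<or> (\<exists>t. t \<noteq> Anti \<and> \<pi> = Perm (leopard_of t))"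
proof (cases \<pi>)
  case Antiperm then show ?thesis by simp
next
  case (Perm \<sigma>)
  have "is_perm \<sigma> \<and> (\<exists>\<rho>. complete_baxter \<rho> \<and> length \<rho> = 2 * length \<sigma> + 1 \<and>
        induced_on even \<rho> = \<sigma> \<and> doubly_alternating (induced_on odd \<rho>)) \<and> odd (length \<sigma>) \<longleftrightarrow>
     (\<exists>t. t \<noteq> Anti \<and> \<sigma> = leopard_of t)" (is "?A \<longleftrightarrow> ?B")
  proof
    assume ?A
    then obtain \<rho> where r: "complete_baxter \<rho>" "length \<rho> = 2 * length \<sigma> + 1" "induced_on even \<rho> = \<sigma>"
      "doubly_alternating (induced_on odd \<rho>)" "odd (length \<sigma>)" by blast
    have "length \<rho> mod 4 = 3" using r(2,5) by presburger
    then obtain t where t: "t \<noteq> Anti" "\<rho> = baxter_of t" using complete_baxter_iff_baxter_of r by blast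
    have "\<sigma> = leopard_of t" using r(3) induced_even[of \<rho>] baxter_of_props[OF t(1)] evens_baxter_of[OF t(1)] t(2) by simp
    then show ?B using t by blast
  next
    assume ?B
    then obtain t where t: "t \<noteq> Anti" "\<sigma> = leopard_of t" by blast
    have p: "is_perm (baxter_of t)" "length (baxter_of t) mod 4 = 3" using baxter_of_props[OF t(1)] by auto
    have c: "complete_baxter (baxter_of t)" "doubly_alternating (induced_on odd (baxter_of t))"
      using complete_baxter_iff_baxter_of[OF p(2)] t(1) by blast+
    have "length (leopard_of t) = length (baxter_of t) div 2" using is_perm_evens(1)[OF p(1)] evens_baxter_of[OF t(1)] by simp
    then have "length (baxter_of t) = 2 * length (leopard_of t) + 1" using p(2) by presburger
    then show ?A using c induced_even[OF p(1)] evens_baxter_of[OF t(1)] leopard_of_props[OF t(1)] t(2) by auto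
  qed
  then show ?thesis using Perm by auto
qed

lemma leopard_of_parts: "t \<noteq> Anti \<Longrightarrow> evens (leopard_of t) = even_of t \<and> odds (leopard_of t) = odd_of t"
proof (induction t)
  case Anti then show ?case by simp
next
  case (Node a b)
  define B where "B = (if a = Anti then [1] else wrap 1 (leopard_of a))"
  have B: "evens B = compl (odd_of a)" "odds B = (if a = Anti then [1] else wrap 1 (even_of a))"
  proof -
    have "evens B = compl (odd_of a) \<and> odds B = (if a = Anti then [1] else wrap 1 (even_of a))"
    proof (cases "a = Anti")
      case True then show ?thesis unfolding B_def by (simp add: evens_def odds_def compl_def)
    next
      case False
      then show ?thesis using Node.IH(1)[OF False] wrap1_parts[of "leopard_of a"] leopard_of_props[OF False]
        unfolding B_def by simp
    qed
    then show "evens B = compl (odd_of a)" "odds B = (if a = Anti then [1] else wrap 1 (even_of a))" by blast+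
  qed
  show ?case
  proof (cases "b = Anti")
    case True then show ?thesis using B unfolding B_def by simp
  next
    case False
    have b: "is_perm (leopard_of b)" "odd (length (leopard_of b))" using leopard_of_props[OF False] by auto
    have "is_perm [1]" using is_perm_incr[of 1] by simp
    then have p: "is_perm ([1] \<ominus> leopard_of b)" by (rule is_perm_skew_sum[OF _ b(1)])
    have e: "even (length ([1] \<ominus> leopard_of b))" using b(2) by simp
    have s: "leopard_of (Node a b) = B \<ominus> [1] \<ominus> leopard_of b" using False unfolding B_def by simp
    have "evens (leopard_of (Node a b)) = evens B \<ominus> [1] \<ominus> evens (leopard_of b)"
      "odds (leopard_of (Node a b)) = odds B \<ominus> odds (leopard_of b)"
      unfolding s skew_parts[OF p e] sep_parts[OF b] by simp_all
    then show ?thesis using B Node.IH(2)[OF False] False by simp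
  qed
qed

lemma even_odd_of_props: "t \<noteq> Anti \<Longrightarrow> is_perm (even_of t) \<and> is_perm (odd_of t) \<and> length (odd_of t) = length (even_of t) + 1"
proof -
  assume t: "t \<noteq> Anti"
  note s = leopard_of_props[OF t] leopard_of_parts[OF t]
  then show ?thesis using is_perm_evens[of "leopard_of t"] is_perm_odds[of "leopard_of t"] by (auto elim!: oddE)
qed

lemma thread_pairs:
  "(\<exists>\<pi>. snow_leopard \<pi> \<and> odd (elength \<pi>) \<and> even_part \<pi> = \<alpha> \<and> odd_part \<pi> = \<beta>) \<longleftrightarrow>
   (\<exists>t. \<alpha> = (if t = Anti then Antiperm else Perm (even_of t)) \<and> \<beta> = Perm (odd_of t))" (is "?A \<longleftrightarrow> ?B")
proof -
  have parts: "even_part (Perm (leopard_of t)) = Perm (even_of t)" "odd_part (Perm (leopard_of t)) = Perm (odd_of t)" if "t \<noteq> Anti" for t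
    using leopard_of_props[OF that] leopard_of_parts[OF that] by (simp_all add: induced_even induced_odd)
  show ?thesis
  proof
    assume ?A
    then obtain \<pi> where \<pi>: "\<pi> = Antiperm \<or> (\<exists>t. t \<noteq> Anti \<and> \<pi> = Perm (leopard_of t))" "even_part \<pi> = \<alpha>" "odd_part \<pi> = \<beta>"
      using snow_leopard_odd_iff by blast
    from \<pi>(1) show ?B
    proof
      assume "\<pi> = Antiperm" then show ?B using \<pi> by (intro exI[of _ Anti]) auto
    next
      assume "\<exists>t. t \<noteq> Anti \<and> \<pi> = Perm (leopard_of t)"
      then show ?B using \<pi>(2,3) parts by metis
    qed
  next
    assume ?B
    then obtain t where t: "\<alpha> = (if t = Anti then Antiperm else Perm (even_of t))" "\<beta> = Perm (odd_of t)" by blast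
    show ?A
    proof (cases "t = Anti")
      case True then show ?A using t by (intro exI[of _ Antiperm]) auto
    next
      case False
      then show ?A using t parts[OF False] snow_leopard_odd_iff[of "Perm (leopard_of t)"]
        by (intro exI[of _ "Perm (leopard_of t)"]) auto
    qed
  qed
qed

section \<open>Odd threads that are skew sums of increasing permutations\<close>

text \<open>
  The first skew summand of the odd thread of a tree with left subtree \<open>a\<close>.
\<close>

definition odd_block :: "shape \<Rightarrow> nat list" where
  "odd_block a = (if a = Anti then [1] else wrap 1 (even_of a))"

text \<open>
  The first skew summand of the even thread of a tree with left subtree \<open>a\<close>.
\<close>

definition odd_compl :: "shape \<Rightarrow> nat list" where
  "odd_compl a = compl (odd_of a)"

text \<open>
  The leaf and the trees whose even thread is decreasing, hence those for which \<open>odd_block\<close> is increasing.  Like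
  Motzkin paths they are built from single steps and pairs of matching steps; under \<open>odd_compl\<close> these
  become the fixed points and the two-cycles of an involution.
\<close>

inductive motzkin :: "shape \<Rightarrow> bool" where
  Anti: "motzkin Anti"
| fixed: "motzkin d \<Longrightarrow> motzkin (Node Anti d)"
| arc: "motzkin a \<Longrightarrow> motzkin d \<Longrightarrow> motzkin (Node (Node a Anti) d)"

lemma odd_of_Node: "odd_of (Node a b) = odd_block a \<ominus> odd_of b"
  by (simp add: odd_block_def)

lemma odd_of_perm: "is_perm (odd_of t)" and even_of_perm: "is_perm (even_of t)"
proof -
  have "is_perm []" by (simp add: is_perm_iff)
  then have "is_perm (odd_of t) \<and> is_perm (even_of t)" using even_odd_of_props[of t] by (cases "t = Anti") simp_all
  then show "is_perm (odd_of t)" "is_perm (even_of t)" by blast+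
qed

lemma is_perm_1 [simp]: "is_perm [1]" "is_perm [Suc 0]"
  by (simp_all add: is_perm_iff)

lemma length_odd_block: "length (odd_block a) = length (odd_of a) + 1"
  using even_odd_of_props[of a] by (auto simp: odd_block_def)

lemma length_odd_compl [simp]: "length (odd_compl a) = length (odd_of a)"
  by (simp add: odd_compl_def)

lemma odd_of_eq_Nil: "odd_of b = [] \<longleftrightarrow> b = Anti"
  using even_odd_of_props[of b] by (cases "b = Anti") auto

lemma compl_skew_sum: "is_perm \<sigma> \<Longrightarrow> compl (\<pi> \<ominus> \<sigma>) = compl \<pi> \<oplus> compl \<sigma>"
  unfolding compl_def skew_sum_def direct_sum_def is_perm_iff by auto

lemma compl_direct_sum: "is_perm \<pi> \<Longrightarrow> compl (\<pi> \<oplus> \<sigma>) = compl \<pi> \<ominus> compl \<sigma>"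
  unfolding compl_def skew_sum_def direct_sum_def is_perm_iff by auto

lemma direct_sum_Nil [simp]: "\<pi> \<oplus> [] = \<pi>"
  by (simp add: direct_sum_def)

lemma compl_1 [simp]: "compl [1] = [1]" "compl [Suc 0] = [Suc 0]"
  by (simp_all add: compl_def)

lemma compl_Nil [simp]: "compl [] = []"
  by (simp add: compl_def)

abbreviation increasing :: "nat list \<Rightarrow> bool" where
  "increasing xs \<equiv> xs = incr_perm (length xs)"

lemma incr_perm_add: "incr_perm (m + n) = incr_perm m \<oplus> incr_perm n"
  by (rule list_eq_entI) (auto simp: ent_direct_sum)

lemma increasing_direct_sum: "increasing (\<pi> \<oplus> \<sigma>) \<longleftrightarrow> increasing \<pi> \<and> increasing \<sigma>"
proof -
  have "\<pi> \<oplus> \<sigma> = \<pi>' \<oplus> \<sigma>' \<longleftrightarrow> \<pi> = \<pi>' \<and> \<sigma> = \<sigma>'" if "length \<pi> = length \<pi>'" for \<pi>' \<sigma>'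
    using that unfolding direct_sum_def by (auto simp: inj_map_eq_map inj_def)
  then show ?thesis by (simp add: incr_perm_add)
qed

lemma hd_skew: "\<lbrakk>\<pi> \<noteq> []; hd \<pi> = 1\<rbrakk> \<Longrightarrow> hd (\<pi> \<ominus> \<sigma>) = length \<sigma> + 1"
  by (cases \<pi>) (auto simp: skew_sum_def)

text \<open>
  If the first summand begins with its minimum, the first entry of a skew sum determines the length
  of the second summand.
\<close>

lemma skew_sum_cancel:
  assumes "\<pi> \<noteq> []" "hd \<pi> = 1" "\<pi>' \<noteq> []" "hd \<pi>' = 1" "\<pi> \<ominus> \<sigma> = \<pi>' \<ominus> \<sigma>'"
  shows "\<pi> = \<pi>' \<and> \<sigma> = \<sigma>'"
proof -
  have "length \<sigma> = length \<sigma>'" using hd_skew[OF assms(1,2), of \<sigma>] hd_skew[OF assms(3,4), of \<sigma>'] assms(5) by simp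
  then show ?thesis using assms(5) unfolding skew_sum_def by (auto simp: inj_map_eq_map inj_def)
qed

lemma hd_incr: "l \<ge> 1 \<Longrightarrow> incr_perm l \<noteq> [] \<and> hd (incr_perm l) = 1"
  unfolding incr_perm_def by (simp add: upt_conv_Cons del: upt_Suc)

lemma hd_odd_block: "odd_block a \<noteq> [] \<and> hd (odd_block a) = 1"
  by (simp add: odd_block_def wrap_def direct_sum_def)

lemma increasing_odd_block: "increasing (odd_block a) \<longleftrightarrow> a = Anti \<or> increasing (compl (even_of a))"
proof -
  have "increasing [1]" by simp
  then show ?thesis unfolding odd_block_def wrap_def by (auto simp: increasing_direct_sum simp del: length_ops)
qed

text \<open>
  An increasing permutation has no nontrivial skew decomposition, so the right subtree is a leaf.
\<close>

lemma increasing_odd_of: "increasing (odd_of c) \<longleftrightarrow> c = Anti \<or> (\<exists>a. c = Node a Anti \<and> increasing (odd_block a))"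
proof (cases c)
  case Anti then show ?thesis by simp
next
  case (Node a b)
  have l: "length (odd_block a \<ominus> odd_of b) \<ge> 1" using length_odd_block[of a] by simp
  have "increasing (odd_block a \<ominus> odd_of b) \<longleftrightarrow> b = Anti \<and> increasing (odd_block a)"
  proof
    assume i: "increasing (odd_block a \<ominus> odd_of b)"
    then have "odd_block a \<ominus> odd_of b = incr_perm (length (odd_block a \<ominus> odd_of b)) \<ominus> []" by simp
    from skew_sum_cancel[OF _ _ _ _ this] hd_odd_block[of a] hd_incr[OF l]
    have "odd_of b = []" by blast
    then show "b = Anti \<and> increasing (odd_block a)" using i by (simp add: odd_of_eq_Nil)
  qed auto
  then show ?thesis using Node by (simp add: odd_of_Node del: odd_of.simps)
qed

lemma motzkin_Node: "motzkin (Node c d) \<longleftrightarrow> (c = Anti \<or> (\<exists>a. c = Node a Anti \<and> motzkin a)) \<and> motzkin d"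
  by (subst motzkin.simps) auto

text \<open>
  The complement of the even thread is \<open>o(c) \<oplus> 1 \<oplus> e(d)\<^sup>c\<close>, with \<open>o\<close> and \<open>e\<close> the odd and even threads of
  the subtrees, so it is increasing iff the summands are.
\<close>

lemma increasing_odd_block_iff_motzkin: "increasing (odd_block t) \<longleftrightarrow> motzkin t"
proof (induction "size t" arbitrary: t rule: less_induct)
  case less
  show ?case
  proof (cases t)
    case Anti then show ?thesis by (simp add: odd_block_def motzkin.Anti)
  next
    case (Node c d)
    have "compl (even_of t) = odd_of c \<oplus> (if d = Anti then [] else [1] \<oplus> compl (even_of d))"
      unfolding Node using odd_of_perm[of c] even_of_perm[of d]
      by (simp add: compl_skew_sum is_perm_skew_sum compl_compl)
    then have "increasing (odd_block t) \<longleftrightarrow> increasing (odd_of c) \<and> increasing (odd_block d)"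
      unfolding increasing_odd_block Node by (auto simp: increasing_direct_sum simp del: length_ops)
    also have "\<dots> \<longleftrightarrow> (c = Anti \<or> (\<exists>a. c = Node a Anti \<and> motzkin a)) \<and> motzkin d"
      unfolding increasing_odd_of using less.hyps[of d] less.hyps unfolding Node by auto
    finally show ?thesis unfolding Node motzkin_Node .
  qed
qed

lemma skew_sums_simps [simp]: "skew_sums [] = []" "skew_sums (\<pi> # \<pi>s) = \<pi> \<ominus> skew_sums \<pi>s"
  by (simp_all add: skew_sums_def)

text \<open>
  The summands of the odd thread are read off along the right spine of the tree.
\<close>

lemma odd_of_eq_skew_sums:
  assumes "\<forall>l\<in>set ls. l \<ge> 1"
  shows "odd_of t = skew_sums (map incr_perm ls) \<longleftrightarrow>
    (\<exists>as. t = foldr Node as Anti \<and> list_all2 (\<lambda>a l. motzkin a \<and> length (odd_block a) = l) as ls)"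
  using assms
proof (induction ls arbitrary: t)
  case Nil then show ?case by (simp add: odd_of_eq_Nil)
next
  case (Cons l ls)
  show ?case
  proof (cases t)
    case Anti
    have "odd_of t \<noteq> skew_sums (map incr_perm (l # ls))"
      using Cons.prems Anti by (auto dest!: arg_cong[of "[]" _ length])
    then show ?thesis using Anti by (auto simp: list_all2_Cons2)
  next
    case (Node a b)
    have l: "l \<ge> 1" using Cons.prems by simp
    have "odd_of t = skew_sums (map incr_perm (l # ls)) \<longleftrightarrow> odd_block a = incr_perm l \<and> odd_of b = skew_sums (map incr_perm ls)"
      using skew_sum_cancel[of "odd_block a" "incr_perm l"] hd_odd_block[of a] hd_incr[OF l]
      unfolding Node odd_of_Node by auto
    also have "odd_block a = incr_perm l \<longleftrightarrow> motzkin a \<and> length (odd_block a) = l"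
      using increasing_odd_block_iff_motzkin[of a] by auto
    also have "odd_of b = skew_sums (map incr_perm ls) \<longleftrightarrow> (\<exists>as. b = foldr Node as Anti \<and> list_all2 (\<lambda>a l. motzkin a \<and> length (odd_block a) = l) as ls)"
      using Cons by simp
    also have "(motzkin a \<and> length (odd_block a) = l) \<and>
        (\<exists>as. b = foldr Node as Anti \<and> list_all2 (\<lambda>a l. motzkin a \<and> length (odd_block a) = l) as ls) \<longleftrightarrow>
      (\<exists>z zs. Node a b = Node z (foldr Node zs Anti) \<and> (motzkin z \<and> length (odd_block z) = l) \<and>
        list_all2 (\<lambda>a l. motzkin a \<and> length (odd_block a) = l) zs ls)" by blast
    also have "\<dots> \<longleftrightarrow> (\<exists>as. Node a b = foldr Node as Anti \<and>
        list_all2 (\<lambda>a l. motzkin a \<and> length (odd_block a) = l) as (l # ls))"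
      unfolding list_all2_Cons2 by force
    finally show ?thesis unfolding Node .
  qed
qed

lemma even_of_foldr: "as \<noteq> [] \<Longrightarrow> even_of (foldr Node as Anti) = skew_sums_sep1 (map odd_compl as)"
proof (induction as)
  case Nil then show ?case by simp
next
  case (Cons a as)
  then show ?case by (cases as) (simp_all add: odd_compl_def)
qed

section \<open>Involutions avoiding 3412\<close>

definition inv3412 :: "nat list \<Rightarrow> bool" where
  "inv3412 \<rho> \<longleftrightarrow> is_perm \<rho> \<and> (\<forall>i\<in>{1..length \<rho>}. ent \<rho> (ent \<rho> i) = i) \<and>
    (\<forall>i j k l. 1 \<le> i \<and> i < j \<and> j < k \<and> k < l \<and> l \<le> length \<rho> \<longrightarrow>
      \<not> (ent \<rho> k < ent \<rho> l \<and> ent \<rho> l < ent \<rho> i \<and> ent \<rho> i < ent \<rho> j))"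

lemma involution_iff:
  "involution \<rho> \<longleftrightarrow> is_perm \<rho> \<and> (\<forall>i\<in>{1..length \<rho>}. ent \<rho> (ent \<rho> i) = i)"
proof (cases "is_perm \<rho>")
  case True
  have "perm_inverse \<rho> = \<rho>" if h: "\<forall>i\<in>{1..length \<rho>}. ent \<rho> (ent \<rho> i) = i"
  proof (rule list_eq_entI)
    fix u assume u: "u \<in> {1..length \<rho>}"
    obtain i where "i \<in> {1..length \<rho>}" "ent \<rho> i = u" using perm_ent_surj[OF True u] .
    then show "ent (perm_inverse \<rho>) u = ent \<rho> u" using ent_perm_inverse[OF True] h by metis
  qed simp
  moreover have "ent \<rho> (ent \<rho> i) = i" if "perm_inverse \<rho> = \<rho>" "i \<in> {1..length \<rho>}" for i
    using ent_perm_inverse[OF True that(2)] that(1) by simp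
  ultimately show ?thesis using True unfolding involution_def by blast
qed (simp add: involution_def)

lemma subseq_Cons_drop:
  "subseq (x # xs) (drop m ys) \<longleftrightarrow> (\<exists>i. m \<le> i \<and> i < length ys \<and> ys ! i = x \<and> subseq xs (drop (Suc i) ys))"
proof
  assume "subseq (x # xs) (drop m ys)"
  then obtain us v vs where u: "drop m ys = us @ v # vs" "x = v" "subseq xs vs"
    by (auto dest: list_emb_ConsD)
  have m: "m \<le> length ys" using u(1) by (metis append_is_Nil_conv drop_all list.distinct(1) nat_le_linear)
  have "length ys = m + length us + 1 + length vs" using arg_cong[OF u(1), of length] m by simp
  moreover have "ys ! (m + length us) = v" 
    using arg_cong[OF u(1), of "\<lambda>z. z ! length us"] m by (simp add: nth_append)
  moreover have "drop (Suc (m + length us)) ys = vs"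
    using arg_cong[OF u(1), of "drop (Suc (length us))"] by (simp add: add.commute)
  ultimately show "\<exists>i. m \<le> i \<and> i < length ys \<and> ys ! i = x \<and> subseq xs (drop (Suc i) ys)"
    using u by (intro exI[of _ "m + length us"]) auto
next
  assume "\<exists>i. m \<le> i \<and> i < length ys \<and> ys ! i = x \<and> subseq xs (drop (Suc i) ys)"
  then obtain i where i: "m \<le> i" "i < length ys" "ys ! i = x" "subseq xs (drop (Suc i) ys)" by blast
  have "drop i ys = x # drop (Suc i) ys" using i Cons_nth_drop_Suc by metis
  then have "subseq (x # xs) (drop i ys)" using i(4) by simp
  moreover have "drop i ys = drop (i - m) (drop m ys)" using i(1) by simp
  then have "subseq (drop i ys) (drop m ys)" by (metis suffix_drop suffix_imp_subseq)
  ultimately show "subseq (x # xs) (drop m ys)" by (rule subseq_order.trans)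
qed

lemma same_order_3412:
  "same_relative_order xs [3, 4, 1, 2] \<longleftrightarrow> (\<exists>a b c d. xs = [a, b, c, d] \<and> c < d \<and> d < a \<and> a < b)"
proof
  assume h: "same_relative_order xs [3, 4, 1, 2]"
  then have "length xs = Suc (Suc (Suc (Suc 0)))" by (simp add: same_relative_order_def)
  then obtain a b c d where x: "xs = [a, b, c, d]" by (auto simp: length_Suc_conv)
  have "xs ! i < xs ! j \<longleftrightarrow> [3, 4, 1, 2::nat] ! i < [3, 4, 1, 2] ! j" if "i < 4" "j < 4" for i j
    using h that x unfolding same_relative_order_def by simp
  from this[of 2 3] this[of 3 0] this[of 0 1]
  show "\<exists>a b c d. xs = [a, b, c, d] \<and> c < d \<and> d < a \<and> a < b" using x by (auto simp: numeral_eq_Suc)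
next
  assume "\<exists>a b c d. xs = [a, b, c, d] \<and> c < d \<and> d < a \<and> a < b"
  then show "same_relative_order xs [3, 4, 1, 2]"
    unfolding same_relative_order_def by (auto simp: less_Suc_eq)
qed

lemma avoids_3412_iff:
  "avoids \<rho> [3, 4, 1, 2] \<longleftrightarrow> (\<forall>i j k l. 1 \<le> i \<and> i < j \<and> j < k \<and> k < l \<and> l \<le> length \<rho> \<longrightarrow>
      \<not> (ent \<rho> k < ent \<rho> l \<and> ent \<rho> l < ent \<rho> i \<and> ent \<rho> i < ent \<rho> j))"
proof -
  have sub: "subseq [a, b, c, d] (drop 0 \<rho>) \<longleftrightarrow> (\<exists>i j k l. i < j \<and> j < k \<and> k < l \<and> l < length \<rho> \<and>
      \<rho> ! i = a \<and> \<rho> ! j = b \<and> \<rho> ! k = c \<and> \<rho> ! l = d)" (is "_ \<longleftrightarrow> ?odd_compl") for a b c d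
  proof
    assume ?odd_compl
    then obtain i j k l where h: "i < j" "j < k" "k < l" "l < length \<rho>"
      "\<rho> ! i = a" "\<rho> ! j = b" "\<rho> ! k = c" "\<rho> ! l = d" by blast
    then have "i < length \<rho>" "j < length \<rho>" "k < length \<rho>" by simp_all
    then show "subseq [a, b, c, d] (drop 0 \<rho>)" unfolding subseq_Cons_drop Suc_le_eq using h list_emb_Nil by blast
  next
    show ?odd_compl if "subseq [a, b, c, d] (drop 0 \<rho>)"
      using that unfolding subseq_Cons_drop Suc_le_eq by blast
  qed
  have "avoids \<rho> [3, 4, 1, 2] \<longleftrightarrow> \<not> (\<exists>a b c d. subseq [a, b, c, d] (drop 0 \<rho>) \<and> c < d \<and> d < a \<and> a < b)"
    unfolding avoids_def same_order_3412 drop_0 by blast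
  also have "\<dots> \<longleftrightarrow> (\<forall>i j k l. i < j \<and> j < k \<and> k < l \<and> l < length \<rho> \<longrightarrow>
      \<not> (\<rho> ! k < \<rho> ! l \<and> \<rho> ! l < \<rho> ! i \<and> \<rho> ! i < \<rho> ! j))"
    unfolding sub by blast
  also have "\<dots> \<longleftrightarrow> (\<forall>i j k l. 1 \<le> i \<and> i < j \<and> j < k \<and> k < l \<and> l \<le> length \<rho> \<longrightarrow>
      \<not> (ent \<rho> k < ent \<rho> l \<and> ent \<rho> l < ent \<rho> i \<and> ent \<rho> i < ent \<rho> j))" (is "?A \<longleftrightarrow> ?B")
  proof
    assume A: ?A
    show ?B
    proof (intro allI impI)
      fix i j k l assume h: "1 \<le> i \<and> i < j \<and> j < k \<and> k < l \<and> l \<le> length \<rho>"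
      then have "i - 1 < j - 1 \<and> j - 1 < k - 1 \<and> k - 1 < l - 1 \<and> l - 1 < length \<rho>" by auto
      then show "\<not> (ent \<rho> k < ent \<rho> l \<and> ent \<rho> l < ent \<rho> i \<and> ent \<rho> i < ent \<rho> j)"
        using A unfolding ent_def by blast
    qed
  next
    assume B: ?B
    show ?A
    proof (intro allI impI)
      fix i j k l assume h: "i < j \<and> j < k \<and> k < l \<and> l < length \<rho>"
      then have "1 \<le> Suc i \<and> Suc i < Suc j \<and> Suc j < Suc k \<and> Suc k < Suc l \<and> Suc l \<le> length \<rho>" by auto
      from B[rule_format, OF this] show "\<not> (\<rho> ! k < \<rho> ! l \<and> \<rho> ! l < \<rho> ! i \<and> \<rho> ! i < \<rho> ! j)"
        unfolding ent_def by simp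
    qed
  qed
  finally show ?thesis .
qed

lemma inv3412_iff: "involution \<rho> \<and> avoids \<rho> [3, 4, 1, 2] \<longleftrightarrow> inv3412 \<rho>"
  unfolding involution_iff avoids_3412_iff inv3412_def by blast

lemma inv3412_direct_sum:
  assumes "inv3412 \<pi>" "inv3412 \<sigma>"
  shows "inv3412 (\<pi> \<oplus> \<sigma>)"
proof -
  let ?n = "length \<pi>" and ?m = "length \<sigma>"
  have p: "is_perm \<pi>" "is_perm \<sigma>" using assms unfolding inv3412_def by auto
  have inv: "\<And>i. i \<in> {1..?n} \<Longrightarrow> ent \<pi> (ent \<pi> i) = i" "\<And>i. i \<in> {1..?m} \<Longrightarrow> ent \<sigma> (ent \<sigma> i) = i"
    using assms unfolding inv3412_def by auto
  have e: "ent (\<pi> \<oplus> \<sigma>) i = (if i \<le> ?n then ent \<pi> i else ?n + ent \<sigma> (i - ?n))" if "1 \<le> i" "i \<le> ?n + ?m" for i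
    by (rule ent_direct_sum[OF that])
  have r: "ent \<pi> i \<in> {1..?n}" if "i \<in> {1..?n}" for i using ent_range[OF p(1) that] .
  have r2: "ent \<sigma> (i - ?n) \<in> {1..?m}" if "i \<in> {?n + 1..?n + ?m}" for i by (rule ent_range[OF p(2)]) (use that in auto)
  have left: "i \<le> ?n \<longleftrightarrow> ent (\<pi> \<oplus> \<sigma>) i \<le> ?n" if "1 \<le> i" "i \<le> ?n + ?m" for i
    using e[OF that] r[of i] r2[of i] that by auto
  show ?thesis unfolding inv3412_def
  proof (intro conjI ballI allI impI)
    show "is_perm (\<pi> \<oplus> \<sigma>)" by (rule is_perm_direct_sum[OF p])
    fix i assume i: "i \<in> {1..length (\<pi> \<oplus> \<sigma>)}"
    show "ent (\<pi> \<oplus> \<sigma>) (ent (\<pi> \<oplus> \<sigma>) i) = i"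
    proof (cases "i \<le> ?n")
      case True then show ?thesis using e[of i] e[of "ent \<pi> i"] i r[of i] inv(1)[of i] by simp
    next
      case False
      then have "i - ?n \<in> {1..?m}" using i by auto
      then have "ent \<sigma> (ent \<sigma> (i - ?n)) = i - ?n" by (rule inv(2))
      then show ?thesis using False e[of i] e[of "?n + ent \<sigma> (i - ?n)"] i r2[of i] by simp
    qed
  next
    fix i j k l assume h: "1 \<le> i \<and> i < j \<and> j < k \<and> k < l \<and> l \<le> length (\<pi> \<oplus> \<sigma>)"
    show "\<not> (ent (\<pi> \<oplus> \<sigma>) k < ent (\<pi> \<oplus> \<sigma>) l \<and> ent (\<pi> \<oplus> \<sigma>) l < ent (\<pi> \<oplus> \<sigma>) i \<and> ent (\<pi> \<oplus> \<sigma>) i < ent (\<pi> \<oplus> \<sigma>) j)"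
    proof
      assume a: "ent (\<pi> \<oplus> \<sigma>) k < ent (\<pi> \<oplus> \<sigma>) l \<and> ent (\<pi> \<oplus> \<sigma>) l < ent (\<pi> \<oplus> \<sigma>) i \<and> ent (\<pi> \<oplus> \<sigma>) i < ent (\<pi> \<oplus> \<sigma>) j"
      show False
      proof (cases "i \<le> ?n")
        case True
        then have "ent (\<pi> \<oplus> \<sigma>) i \<le> ?n" using left[of i] h by simp
        then have "l \<le> ?n" using left[of l] h a by simp
        then have "1 \<le> i \<and> i < j \<and> j < k \<and> k < l \<and> l \<le> ?n" using h by simp
        moreover have "ent \<pi> k < ent \<pi> l \<and> ent \<pi> l < ent \<pi> i \<and> ent \<pi> i < ent \<pi> j" using a e h \<open>l \<le> ?n\<close> by simp
        ultimately show False using assms(1) unfolding inv3412_def by blast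
      next
        case False
        then have "1 \<le> i - ?n \<and> i - ?n < j - ?n \<and> j - ?n < k - ?n \<and> k - ?n < l - ?n \<and> l - ?n \<le> ?m" using h by auto
        moreover have "ent \<sigma> (k-?n) < ent \<sigma> (l-?n) \<and> ent \<sigma> (l-?n) < ent \<sigma> (i-?n) \<and> ent \<sigma> (i-?n) < ent \<sigma> (j-?n)"
          using a e h False by simp
        ultimately show False using assms(2) unfolding inv3412_def by blast
      qed
    qed
  qed
qed

lemma ent_arc:
  assumes "1 \<le> i" "i \<le> length \<sigma> + 2"
  shows "ent ([1] \<ominus> \<sigma> \<ominus> [1]) i = (if i = 1 then length \<sigma> + 2 else if i = length \<sigma> + 2 then 1 else ent \<sigma> (i - 1) + 1)"
proof -
  have one: "ent [1] 1 = 1" by (simp add: ent_def)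
  consider "i = 1" | "2 \<le> i" "i \<le> length \<sigma> + 1" | "i = length \<sigma> + 2" using assms by linarith
  then show ?thesis
    by cases (use one in \<open>auto simp: ent_skew_sum\<close>)
qed

lemma inv3412_arc:
  assumes "inv3412 \<sigma>"
  shows "inv3412 ([1] \<ominus> \<sigma> \<ominus> [1])"
proof -
  let ?m = "length \<sigma>" and ?W = "[1] \<ominus> \<sigma> \<ominus> [1]"
  have p: "is_perm \<sigma>" and inv: "\<And>i. i \<in> {1..?m} \<Longrightarrow> ent \<sigma> (ent \<sigma> i) = i" using assms unfolding inv3412_def by auto
  have len: "length ?W = ?m + 2" by simp
  have r: "ent \<sigma> (i - 1) \<in> {1..?m}" if "2 \<le> i" "i \<le> ?m + 1" for i by (rule ent_range[OF p]) (use that in auto)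
  have rW: "ent ?W i \<in> {1..?m+2}" if "1 \<le> i" "i \<le> ?m + 2" for i
    using ent_arc[OF that] r[of i] that by auto
  have ends: "ent ?W 1 = ?m + 2" "ent ?W (?m + 2) = 1"
    using ent_arc[of 1 \<sigma>] ent_arc[of "?m + 2" \<sigma>] by simp_all
  show ?thesis unfolding inv3412_def len
  proof (intro conjI ballI allI impI)
    show "is_perm ?W" using p by (intro is_perm_skew_sum) auto
    fix i assume i: "i \<in> {1..?m+2}"
    consider "i = 1" | "2 \<le> i" "i \<le> ?m + 1" | "i = ?m + 2" using i by fastforce
    then show "ent ?W (ent ?W i) = i"
    proof cases
      case 2
      then have "i - 1 \<in> {1..?m}" by auto
      then have "ent \<sigma> (ent \<sigma> (i - 1)) = i - 1" by (rule inv)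
      then show ?thesis using 2 ent_arc[of i \<sigma>] ent_arc[of "ent \<sigma> (i-1) + 1" \<sigma>] r[of i] by auto
    next
      case 1 then show ?thesis using ends by metis
    next
      case 3 then show ?thesis using ends by metis
    qed
  next
    fix i j k l assume h: "1 \<le> i \<and> i < j \<and> j < k \<and> k < l \<and> l \<le> ?m + 2"
    show "\<not> (ent ?W k < ent ?W l \<and> ent ?W l < ent ?W i \<and> ent ?W i < ent ?W j)"
    proof
      assume a: "ent ?W k < ent ?W l \<and> ent ?W l < ent ?W i \<and> ent ?W i < ent ?W j"
      have "i \<noteq> 1" using a rW[of j] h ent_arc[of 1 \<sigma>] by auto
      moreover have "l \<noteq> ?m + 2" using a rW[of k] h ent_arc[of "?m+2" \<sigma>] by auto
      ultimately have h': "2 \<le> i" "l \<le> ?m + 1" using h by auto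
      have "ent ?W x = ent \<sigma> (x - 1) + 1" if "2 \<le> x" "x \<le> ?m + 1" for x
        using ent_arc[of x \<sigma>] that by auto
      then have "ent \<sigma> (k-1) < ent \<sigma> (l-1) \<and> ent \<sigma> (l-1) < ent \<sigma> (i-1) \<and> ent \<sigma> (i-1) < ent \<sigma> (j-1)"
        using a h h' by simp
      moreover have "1 \<le> i - 1 \<and> i - 1 < j - 1 \<and> j - 1 < k - 1 \<and> k - 1 < l - 1 \<and> l - 1 \<le> ?m" using h h' by auto
      ultimately show False using assms unfolding inv3412_def by blast
    qed
  qed
qed

lemma inv3412_restrict:
  assumes "inv3412 \<rho>" "a + m \<le> length \<rho>" "\<And>i. i \<in> {a+1..a+m} \<Longrightarrow> ent \<rho> i \<in> {a+1..a+m}"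
  obtains \<sigma> where "length \<sigma> = m" "inv3412 \<sigma>" "\<And>i. i \<in> {1..m} \<Longrightarrow> ent \<rho> (a + i) = a + ent \<sigma> i"
proof -
  define \<sigma> where "\<sigma> = map (\<lambda>i. ent \<rho> (a + i) - a) [1..<Suc m]"
  have len: "length \<sigma> = m" by (simp add: \<sigma>_def)
  have e: "ent \<rho> (a + i) = a + ent \<sigma> i" "ent \<sigma> i \<in> {1..m}" if i: "i \<in> {1..m}" for i
  proof -
    have "i - 1 < m" "1 + (i - 1) = i" using i by auto
    then have "ent \<sigma> i = ent \<rho> (a + i) - a"
      unfolding ent_def[of \<sigma>] by (simp add: \<sigma>_def del: upt_Suc)
    then show "ent \<rho> (a + i) = a + ent \<sigma> i" "ent \<sigma> i \<in> {1..m}" using assms(3)[of "a + i"] i by auto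
  qed
  have inv: "ent \<sigma> (ent \<sigma> i) = i" if i: "i \<in> {1..m}" for i
  proof -
    have "ent \<rho> (ent \<rho> (a + i)) = a + i" using assms(1,2) i unfolding inv3412_def by auto
    then show ?thesis using e(1)[OF i] e(1)[OF e(2)[OF i]] by simp
  qed
  have "bij_betw (ent \<sigma>) {1..m} {1..m}"
    by (rule bij_betwI[of _ _ _ "ent \<sigma>"]) (use e(2) inv in auto)
  then have p: "is_perm \<sigma>" unfolding is_perm_ent len .
  have "\<not> (ent \<sigma> k < ent \<sigma> l \<and> ent \<sigma> l < ent \<sigma> i \<and> ent \<sigma> i < ent \<sigma> j)"
    if h: "1 \<le> i \<and> i < j \<and> j < k \<and> k < l \<and> l \<le> m" for i j k l
  proof -
    have "1 \<le> a + i \<and> a + i < a + j \<and> a + j < a + k \<and> a + k < a + l \<and> a + l \<le> length \<rho>" using h assms(2) by auto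
    then have "\<not> (ent \<rho> (a+k) < ent \<rho> (a+l) \<and> ent \<rho> (a+l) < ent \<rho> (a+i) \<and> ent \<rho> (a+i) < ent \<rho> (a+j))"
      using assms(1) unfolding inv3412_def by blast
    then show ?thesis using h by (simp add: e(1))
  qed
  then have "inv3412 \<sigma>" unfolding inv3412_def len using p inv by blast
  then show ?thesis using that len e(1) by blast
qed

text \<open>
  Let \<open>j\<close> be the first entry, so that 1 is at position \<open>j\<close>.  A position \<open>i\<close> strictly between 1 and \<open>j\<close>
  cannot have a value \<open>p > j\<close>: the positions \<open>1 < i < j < p\<close> would carry \<open>j, p, 1, i\<close>, an occurrence
  of 3412.  Hence \<open>{2..j - 1}\<close> and \<open>{j + 1..}\<close> are each mapped to themselves.
\<close>

lemma inv3412_decompose: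
  assumes "inv3412 \<rho>" "\<rho> \<noteq> []"
  shows "(\<exists>\<tau>. inv3412 \<tau> \<and> \<rho> = [1] \<oplus> \<tau>) \<or> (\<exists>\<sigma> \<tau>. inv3412 \<sigma> \<and> inv3412 \<tau> \<and> \<rho> = ([1] \<ominus> \<sigma> \<ominus> [1]) \<oplus> \<tau>)"
proof -
  let ?n = "length \<rho>"
  have p: "is_perm \<rho>" and inv: "\<And>i. i \<in> {1..?n} \<Longrightarrow> ent \<rho> (ent \<rho> i) = i" using assms unfolding inv3412_def by auto
  have r: "\<And>i. i \<in> {1..?n} \<Longrightarrow> ent \<rho> i \<in> {1..?n}" using ent_range[OF p] .
  have n: "?n \<ge> 1" using assms(2) by (cases \<rho>) auto
  define j where "j = ent \<rho> 1"
  have j: "j \<in> {1..?n}" "ent \<rho> j = 1" using r[of 1] inv[of 1] n unfolding j_def by auto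
  have mid: "ent \<rho> i \<in> {2..j - 1}" if i: "i \<in> {2..j-1}" for i
  proof -
    have ir: "i \<in> {1..?n}" using i j by auto
    have "ent \<rho> i \<noteq> 1" using inv[OF ir] i unfolding j_def by (auto)
    moreover have "ent \<rho> i \<noteq> j" using inv[OF ir] i j(2) by auto
    moreover have "\<not> ent \<rho> i > j"
    proof
      assume gt: "ent \<rho> i > j"
      have "1 \<le> (1::nat) \<and> 1 < i \<and> i < j \<and> j < ent \<rho> i \<and> ent \<rho> i \<le> ?n" using i gt r[OF ir] by auto
      moreover have "ent \<rho> j < ent \<rho> (ent \<rho> i) \<and> ent \<rho> (ent \<rho> i) < ent \<rho> 1 \<and> ent \<rho> 1 < ent \<rho> i"
        using j(2) inv[OF ir] i gt unfolding j_def[symmetric] by auto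
      ultimately show False using assms(1) unfolding inv3412_def by blast
    qed
    ultimately show ?thesis using r[OF ir] by auto
  qed
  have low: "ent \<rho> i \<le> j" if "i \<in> {1..j}" for i
  proof -
    have "i = 1 \<or> i = j \<or> i \<in> {2..j-1}" using that by auto
    moreover have "ent \<rho> i = j" if "i = 1" using that j_def by simp
    ultimately show ?thesis using mid[of i] j by auto
  qed
  have high: "ent \<rho> i \<in> {j+1..?n}" if i: "i \<in> {j+1..?n}" for i
  proof -
    have ir: "i \<in> {1..?n}" using i by auto
    have "\<not> ent \<rho> i \<le> j" using low[of "ent \<rho> i"] inv[OF ir] r[OF ir] i by auto
    then show ?thesis using r[OF ir] by auto
  qed
  have jn: "j + (?n - j) = ?n" using j by auto
  obtain \<tau> where \<tau>: "length \<tau> = ?n - j" "inv3412 \<tau>" "\<And>i. i \<in> {1..?n - j} \<Longrightarrow> ent \<rho> (j + i) = j + ent \<tau> i"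
    using inv3412_restrict[OF assms(1), of j "?n - j"] high jn by auto
  have right: "ent \<rho> i = j + ent \<tau> (i - j)" if "i \<in> {j+1..?n}" for i
  proof -
    have "ent \<rho> (j + (i - j)) = j + ent \<tau> (i - j)" by (rule \<tau>(3)) (use that in auto)
    then show ?thesis using that by simp
  qed
  show ?thesis
  proof (cases "j = 1")
    case True
    have "\<rho> = [1] \<oplus> \<tau>"
    proof (rule list_eq_entI)
      show len: "length \<rho> = length ([1] \<oplus> \<tau>)" using \<tau>(1) True n by simp
      fix i assume i: "i \<in> {1..length ([1] \<oplus> \<tau>)}"
      show "ent \<rho> i = ent ([1] \<oplus> \<tau>) i"
      proof (cases "i = 1")
        case True then show ?thesis using j_def \<open>j = 1\<close> by (simp add: ent_direct_sum) (simp add: ent_def)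
      next
        case False
        then have "i \<in> {j+1..?n}" using i len True by auto
        then show ?thesis using right[of i] True i by (simp add: ent_direct_sum)
      qed
    qed
    then show ?thesis using \<tau>(2) by blast
  next
    case False
    then have j2: "j \<ge> 2" using j by auto
    have le: "1 + (j - 2) \<le> ?n" using j2 j(1) by auto
    have iv: "{1 + 1..1 + (j - 2)} = {2..j - 1}" using j2 by auto
    obtain \<sigma> where \<sigma>: "length \<sigma> = j - 2" "inv3412 \<sigma>" "\<And>i. i \<in> {1..j - 2} \<Longrightarrow> ent \<rho> (1 + i) = 1 + ent \<sigma> i"
      using inv3412_restrict[OF assms(1) le, unfolded iv, OF mid] by blast
    let ?W = "[1] \<ominus> \<sigma> \<ominus> [1]"
    have lW: "length ?W = j" using \<sigma>(1) j2 by simp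
    have "\<rho> = ?W \<oplus> \<tau>"
    proof (rule list_eq_entI)
      show len: "length \<rho> = length (?W \<oplus> \<tau>)" using \<tau>(1) \<sigma>(1) j2 jn by simp
      fix i assume i: "i \<in> {1..length (?W \<oplus> \<tau>)}"
      then have e: "ent (?W \<oplus> \<tau>) i = (if i \<le> j then ent ?W i else j + ent \<tau> (i - j))"
        using ent_direct_sum[of i ?W \<tau>] lW by simp
      have W: "ent ?W i = (if i = 1 then j else if i = j then 1 else ent \<sigma> (i - 1) + 1)" if "i \<le> j"
        using ent_arc[of i \<sigma>] that i \<sigma>(1) j2 by auto
      consider "i = 1" | "i = j" | "i \<in> {2..j-1}" | "i \<in> {j+1..?n}" using i len by fastforce
      then show "ent \<rho> i = ent (?W \<oplus> \<tau>) i"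
      proof cases
        case 1 then show ?thesis using e W j2 j_def by simp
      next
        case 2 then show ?thesis using e W j2 j(2) by simp
      next
        case 3
        then have "ent \<rho> (1 + (i - 1)) = 1 + ent \<sigma> (i - 1)" by (intro \<sigma>(3)) auto
        then show ?thesis using e W 3 by auto
      next
        case 4 then show ?thesis using e right[OF 4] by simp
      qed
    qed
    then show ?thesis using \<tau>(2) \<sigma>(2) by blast
  qed
qed

lemma odd_compl_simps:
  "odd_compl Anti = []"
  "odd_compl (Node Anti d) = [1] \<oplus> odd_compl d"
  "odd_compl (Node (Node a Anti) d) = ([1] \<ominus> odd_compl a \<ominus> [1]) \<oplus> odd_compl d"
proof -
  show "odd_compl Anti = []" by (simp add: odd_compl_def)
  have N: "odd_compl (Node c d) = compl (odd_block c) \<oplus> odd_compl d" for c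
    unfolding odd_compl_def odd_of_Node by (rule compl_skew_sum[OF odd_of_perm])
  show "odd_compl (Node Anti d) = [1] \<oplus> odd_compl d" unfolding N by (simp add: odd_block_def)
  have "is_perm (odd_compl a)" unfolding odd_compl_def by (rule is_perm_compl[OF odd_of_perm])
  then have "compl (wrap 1 (odd_compl a)) = [1] \<ominus> odd_compl a \<ominus> [1]"
    unfolding wrap_def by (simp add: compl_direct_sum is_perm_compl compl_compl)
  moreover have "odd_block (Node a Anti) = wrap 1 (odd_compl a)" by (simp add: odd_block_def odd_compl_def)
  ultimately show "odd_compl (Node (Node a Anti) d) = ([1] \<ominus> odd_compl a \<ominus> [1]) \<oplus> odd_compl d" unfolding N by simp
qed

text \<open>
  Both sides obey the same recursion.
\<close>

lemma inv3412_iff_motzkin: "inv3412 \<rho> \<longleftrightarrow> (\<exists>t. motzkin t \<and> \<rho> = odd_compl t)"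
proof
  show "\<exists>t. motzkin t \<and> \<rho> = odd_compl t" if "inv3412 \<rho>"
    using that
  proof (induction "length \<rho>" arbitrary: \<rho> rule: less_induct)
    case less
    show ?case
    proof (cases "\<rho> = []")
      case True then show ?thesis using motzkin.Anti odd_compl_simps(1) by metis
    next
      case False
      from inv3412_decompose[OF less.prems False] show ?thesis
      proof
        assume "\<exists>\<tau>. inv3412 \<tau> \<and> \<rho> = [1] \<oplus> \<tau>"
        then obtain \<tau> where t: "inv3412 \<tau>" "\<rho> = [1] \<oplus> \<tau>" by blast
        then obtain d where "motzkin d" "\<tau> = odd_compl d" using less.hyps[of \<tau>] by auto
        then show ?thesis using t(2) motzkin.fixed odd_compl_simps(2) by metis
      next
        assume "\<exists>\<sigma> \<tau>. inv3412 \<sigma> \<and> inv3412 \<tau> \<and> \<rho> = ([1] \<ominus> \<sigma> \<ominus> [1]) \<oplus> \<tau>"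
        then obtain \<sigma> \<tau> where t: "inv3412 \<sigma>" "inv3412 \<tau>" "\<rho> = ([1] \<ominus> \<sigma> \<ominus> [1]) \<oplus> \<tau>" by blast
        then obtain a d where "motzkin a" "\<sigma> = odd_compl a" "motzkin d" "\<tau> = odd_compl d"
          using less.hyps[of \<sigma>] less.hyps[of \<tau>] by auto
        then show ?thesis using t(3) motzkin.arc odd_compl_simps(3) by metis
      qed
    qed
  qed
next
  have nil: "inv3412 []" by (simp add: inv3412_def is_perm_iff)
  have one: "inv3412 [1]" by (auto simp: inv3412_def ent_def)
  have "inv3412 (odd_compl t)" if "motzkin t" for t
    using that by induction (simp_all add: odd_compl_simps nil one inv3412_direct_sum inv3412_arc del: One_nat_def)
  then show "inv3412 \<rho>" if "\<exists>t. motzkin t \<and> \<rho> = odd_compl t" using that by blast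
qed

lemma motzkin_of_length: "\<exists>t. motzkin t \<and> length (odd_compl t) = k"
proof (induction k)
  case 0 then show ?case using motzkin.Anti odd_compl_simps(1) by (metis list.size(3))
next
  case (Suc k)
  then obtain t where "motzkin t" "length (odd_compl t) = k" by blast
  then have "motzkin (Node Anti t)" "length (odd_compl (Node Anti t)) = Suc k" by (auto intro: motzkin.fixed simp: odd_compl_simps simp del: length_odd_compl)
  then show ?case by blast
qed

section \<open>The entangled even threads\<close>

theorem corollary5p3:
  fixes ls :: "nat list"
  assumes "length ls \<ge> 1" and "\<forall>l\<in>set ls. l \<ge> 1"
  shows "odd_thread (Perm (skew_sums (map incr_perm ls))) \<and>
    {\<alpha>. even_thread \<alpha> \<and> entangled \<alpha> (Perm (skew_sums (map incr_perm ls)))} =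
    {Perm (skew_sums_sep1 \<pi>s) | \<pi>s. length \<pi>s = length ls \<and>
       (\<forall>j<length ls. involution (\<pi>s ! j) \<and> avoids (\<pi>s ! j) [3, 4, 1, 2] \<and>
          length (\<pi>s ! j) = ls ! j - 1)}"
proof
  let ?\<beta> = "skew_sums (map incr_perm ls)"
  let ?ok = "\<lambda>as. list_all2 (\<lambda>a l. motzkin a \<and> length (odd_block a) = l) as ls"
  note od_iff = odd_of_eq_skew_sums[OF assms(2)]
  have "\<exists>as. ?ok as"
    using assms(2)
  proof (induction ls)
    case Nil then show ?case by simp
  next
    case (Cons l ls)
    obtain a where "motzkin a" "length (odd_compl a) = l - 1" using motzkin_of_length by blast
    then have "motzkin a \<and> length (odd_block a) = l" using Cons.prems by (simp add: length_odd_block)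
    moreover obtain as where "list_all2 (\<lambda>a l. motzkin a \<and> length (odd_block a) = l) as ls" using Cons by auto
    ultimately show ?case by (intro exI[of _ "a # as"]) simp
  qed
  then obtain t where t: "odd_of t = ?\<beta>" using od_iff by blast
  show "odd_thread (Perm ?\<beta>)"
  proof -
    have "\<exists>\<pi>. snow_leopard \<pi> \<and> odd (elength \<pi>) \<and>
        even_part \<pi> = (if t = Anti then Antiperm else Perm (even_of t)) \<and> odd_part \<pi> = Perm ?\<beta>"
      unfolding thread_pairs using t by metis
    then show ?thesis unfolding odd_thread_def by metis
  qed
  have ne: "as \<noteq> []" if "?ok as" for as using list_all2_lengthD[OF that] assms(1) by auto
  have ok_iff: "(\<exists>as. \<pi>s = map odd_compl as \<and> ?ok as) \<longleftrightarrow> length \<pi>s = length ls \<and>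
       (\<forall>j<length ls. involution (\<pi>s ! j) \<and> avoids (\<pi>s ! j) [3, 4, 1, 2] \<and> length (\<pi>s ! j) = ls ! j - 1)" for \<pi>s
  proof -
    have "(\<exists>as. \<pi>s = map odd_compl as \<and> ?ok as) \<longleftrightarrow> list_all2 (\<lambda>\<rho> l. \<exists>a. \<rho> = odd_compl a \<and> motzkin a \<and> length (odd_block a) = l) \<pi>s ls"
    proof
      assume "\<exists>as. \<pi>s = map odd_compl as \<and> ?ok as"
      then obtain as where as: "\<pi>s = map odd_compl as" "?ok as" by blast
      from as(2) show "list_all2 (\<lambda>\<rho> l. \<exists>a. \<rho> = odd_compl a \<and> motzkin a \<and> length (odd_block a) = l) \<pi>s ls"
        unfolding as(1) list_all2_map1 by (rule list_all2_mono) blast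
    next
      assume "list_all2 (\<lambda>\<rho> l. \<exists>a. \<rho> = odd_compl a \<and> motzkin a \<and> length (odd_block a) = l) \<pi>s ls"
      then show "\<exists>as. \<pi>s = map odd_compl as \<and> ?ok as"
      proof (induction rule: list_all2_induct)
        case Nil then show ?case by simp
      next
        case (Cons \<rho> \<rho>s l ls)
        then obtain a as where "\<rho> = odd_compl a" "motzkin a" "length (odd_block a) = l" "\<rho>s = map odd_compl as"
          "list_all2 (\<lambda>a l. motzkin a \<and> length (odd_block a) = l) as ls" by blast
        then show ?case by (intro exI[of _ "a # as"]) simp
      qed
    qed
    also have "\<dots> \<longleftrightarrow> list_all2 (\<lambda>\<rho> l. involution \<rho> \<and> avoids \<rho> [3, 4, 1, 2] \<and> length \<rho> = l - 1) \<pi>s ls"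
    proof -
      have "(\<exists>a. \<rho> = odd_compl a \<and> motzkin a \<and> length (odd_block a) = l) \<longleftrightarrow>
          involution \<rho> \<and> avoids \<rho> [3, 4, 1, 2] \<and> length \<rho> = l - 1" if "l \<in> set ls" for \<rho> l
      proof -
        have "length (odd_block a) = l \<longleftrightarrow> length (odd_compl a) = l - 1" for a
          using that assms(2) by (auto simp: length_odd_block)
        then show ?thesis using inv3412_iff[of \<rho>] inv3412_iff_motzkin[of \<rho>] by blast
      qed
      then show ?thesis by (auto simp: list_all2_conv_all_nth)
    qed
    finally show ?thesis by (auto simp: list_all2_conv_all_nth)
  qed
  have "even_thread \<alpha> \<and> entangled \<alpha> (Perm ?\<beta>) \<longleftrightarrow>
    (\<exists>as. \<alpha> = Perm (skew_sums_sep1 (map odd_compl as)) \<and> ?ok as)" for \<alpha>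
  proof -
    have fold: "foldr Node as Anti \<noteq> Anti" "even_of (foldr Node as Anti) = skew_sums_sep1 (map odd_compl as)" if "?ok as" for as
      using ne[OF that] even_of_foldr[of as] by (cases as; simp)+
    have "even_thread \<alpha> \<and> entangled \<alpha> (Perm ?\<beta>) \<longleftrightarrow>
      (\<exists>\<pi>. snow_leopard \<pi> \<and> odd (elength \<pi>) \<and> even_part \<pi> = \<alpha> \<and> odd_part \<pi> = Perm ?\<beta>)"
      unfolding entangled_def even_thread_def odd_thread_def by metis
    also have "\<dots> \<longleftrightarrow> (\<exists>t. \<alpha> = (if t = Anti then Antiperm else Perm (even_of t)) \<and> odd_of t = ?\<beta>)"
      unfolding thread_pairs eperm.inject eq_commute[of ?\<beta>] by (rule refl)
    also have "\<dots> \<longleftrightarrow> (\<exists>as. \<alpha> = (if foldr Node as Anti = Anti then Antiperm else Perm (even_of (foldr Node as Anti))) \<and> ?ok as)"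
      unfolding od_iff by blast
    also have "\<dots> \<longleftrightarrow> (\<exists>as. \<alpha> = Perm (skew_sums_sep1 (map odd_compl as)) \<and> ?ok as)"
    proof (rule iff_exI)
      fix as
      have "?ok as \<Longrightarrow> (if foldr Node as Anti = Anti then Antiperm else Perm (even_of (foldr Node as Anti))) =
        Perm (skew_sums_sep1 (map odd_compl as))" using fold by simp
      then show "(\<alpha> = (if foldr Node as Anti = Anti then Antiperm else Perm (even_of (foldr Node as Anti))) \<and> ?ok as) =
        (\<alpha> = Perm (skew_sums_sep1 (map odd_compl as)) \<and> ?ok as)" by (cases "?ok as") simp_all
    qed
    finally show ?thesis .
  qed
  then show "{\<alpha>. even_thread \<alpha> \<and> entangled \<alpha> (Perm ?\<beta>)} =
    {Perm (skew_sums_sep1 \<pi>s) | \<pi>s. length \<pi>s = length ls \<and>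
       (\<forall>j<length ls. involution (\<pi>s ! j) \<and> avoids (\<pi>s ! j) [3, 4, 1, 2] \<and>
          length (\<pi>s ! j) = ls ! j - 1)}"
    unfolding ok_iff[symmetric] by auto
qed

end
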